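(* Let $W$ denote an irreducible $\mathcal{H}$-module of type $(\alpha,\beta,\rho)$. Then each of $\Omega_0$, $\Omega_1$, $\Omega_2$ acts on $W$ as a scalar multiple of the identity. The scalars are: $q^{-\rho}$ for $\Omega_0$; $\ q[k-\rho-\alpha]+[\alpha]$ for $\Omega_1$; $\ q[h-\rho-\beta]+[\beta]$ for $\Omega_2$.
   Context: Let $h>k\geq 1$ be integers, $\mathbb{F}_q$ a finite field with $q$ elements, $\mathcal{V}$ an $(h+k)$-dimensional vector space over $\mathbb{F}_q$, and $P$ the set of all subspaces of $\mathcal{V}$. Fix $y\in P$ with $\dim y=k$. $\mathrm{Mat}_P(\mathbb{C})$ is the algebra of complex matrices with rows and columns indexed by $P$, acting by left multiplication on the space $V$ of complex column vectors indexed by $P$; $I$ is the identity; $q^{1/2}$ is the positive square root; $[m]=\frac{q^m-1}{q-1}$ for $m\in\mathbb{Z}$. For $0\le i\le k$, $0\le j\le h$ let $P_{i,j}=\{u\in P\mid \dim(u\cap y)=i,\ \dim u=i+j\}$ (these sets partition $P$), and let $E^*_{i,j}$ be the diagonal matrix with $(u,u)$-entry $1$ if $u\in P_{i,j}$ and $0$ otherwise. For $u,v\in P$, $v$ covers $u$ if $u\subseteq v$ and $\dim v=\dim u+1$. If $v$ covers $u$, then $v$ $/$-covers $u$ if $\dim(v\cap y)=\dim(u\cap y)+1$, and $v$ $\backslash$-covers $u$ if $\dim(v\cap y)=\dim(u\cap y)$. $K_1,K_2$ are the diagonal matrices with $(K_1)_{u,u}=q^{\frac k2-i}$, $(K_2)_{u,u}=q^{j-\frac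 h2}$ for $u\in P_{i,j}$. $L_1,L_2$ are the $0/1$ matrices with $(L_1)_{u,v}=1$ iff $v$ $/$-covers $u$, $(L_2)_{u,v}=1$ iff $v$ $\backslash$-covers $u$; $R_1=L_1^t$, $R_2=L_2^t$. $\mathcal{H}$ is the subalgebra of $\mathrm{Mat}_P(\mathbb{C})$ generated by $L_1,L_2,R_1,R_2,K_1^{\pm1},K_2^{\pm1}$. An irreducible $\mathcal{H}$-module is an irreducible $\mathcal{H}$-submodule $W$ of $V$. For each such $W$ it is known (Watanabe) that there exist integers $\alpha,\beta,\rho$ with $0\le\rho$, $0\le\alpha\le\frac{k-\rho}2$, $0\le\beta\le\frac{h-\rho}2$ such that for $0\le i\le k$, $0\le j\le h$, $\dim E^*_{i,j}W=1$ if $\alpha\le i\le k-\rho-\alpha$ and $\rho+\beta\le j\le h-\beta$, and $\dim E^*_{i,j}W=0$ otherwise; $(\alpha,\beta,\rho)$ is called the type of $W$. $F^0,F^+,F^-$ are the $0/1$ matrices such that: $(F^0)_{u,v}=1$ iff $u+v$ $/$-covers both $u$ and $v$, and both $u$ and $v$ $\backslash$-cover $u\cap v$; $(F^+)_{u,v}=1$ iff $u+v$ $\backslash$-covers both $u$ and $v$; $(F^-)_{u,v}=1$ iff both $u$ and $v$ $/$-cover $u\cap v$. Define $$\Omega_0=q^{-\frac{h+k}{2}}\Bigl((q-1)F^{0}K_1^{-1}K_2^{-1}+q^{\frac{h}{2}}K_1^{-1}+q^{\frac{k}{2}}K_2^{-1}-K_1^{-1}K_2^{-1}\Bigr),$$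 $$\Omega_1=q^{-\frac{h}{2}}\Bigl(qF^{0}K_2^{-1}+(q-1)F^{-}K_2^{-1}+\tfrac{q^{\frac{k}{2}+1}K_1K_2^{-1}+q^{\frac{h+k}{2}+1}K_1^{-1}-qK_2^{-1}}{q-1}\Bigr)-\tfrac{q}{q-1}I,$$ $$\Omega_2=q^{-\frac{k}{2}}\Bigl(qF^0K_1^{-1}+(q-1)F^{+}K_1^{-1}+\tfrac{q^{\frac{h}{2}+1}K_1^{-1}K_2+q^{\frac{h+k}{2}+1}K_2^{-1}-qK_1^{-1}}{q-1}\Bigr)-\tfrac{q}{q-1}I.$$ *)

theory Defs
  imports "HOL-Analysis.Analysis"
begin

text \<open>
  The ambient space is an arbitrary vector space of dimension \<open>h + k\<close> over a field with \<open>q\<close>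
  elements, carried by the type \<open>'v\<close>; it is necessarily a finite set, so asking \<open>'v\<close> to be of
  class \<^class>\<open>finite\<close> loses no generality.  Since the subspaces for a variable scalar
  multiplication do not form a type, matrices (and vectors) indexed by the set \<open>P\<close> of subspaces
  are matrices (vectors) indexed by the finite type \<open>'v set\<close> whose entries vanish outside
  \<open>P \<times> P\<close> (outside \<open>P\<close>).  The identity of this matrix algebra is \<open>IP\<close>, not \<open>mat 1\<close>.
\<close>

locale subspace_lattice = vector_space scale
  for scale :: "'f::{field,finite} \<Rightarrow> 'v::{ab_group_add,finite} \<Rightarrow> 'v" +
  fixes q h k :: nat and y :: "'v set"
  assumes card_field: "CARD('f) = q"
    and k_ge_1: "1 \<le> k"
    and k_less_h: "k < h"
    and dim_space: "dim UNIV = h + k"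
    and subspace_y: "subspace y"
    and dim_y: "dim y = k"
begin

definition P :: "'v set set" where
  "P = {u. subspace u}"

definition Pij :: "nat \<Rightarrow> nat \<Rightarrow> 'v set set" where
  "Pij i j = {u \<in> P. dim (u \<inter> y) = i \<and> dim u = i + j}"

definition covers :: "'v set \<Rightarrow> 'v set \<Rightarrow> bool" where
  "covers v u \<longleftrightarrow> u \<subseteq> v \<and> dim v = dim u + 1"

definition slash_covers :: "'v set \<Rightarrow> 'v set \<Rightarrow> bool" where
  "slash_covers v u \<longleftrightarrow> covers v u \<and> dim (v \<inter> y) = dim (u \<inter> y) + 1"

definition backslash_covers :: "'v set \<Rightarrow> 'v set \<Rightarrow> bool" where
  "backslash_covers v u \<longleftrightarrow> covers v u \<and> dim (v \<inter> y) = dim (u \<inter> y)"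

definition subspace_sum :: "'v set \<Rightarrow> 'v set \<Rightarrow> 'v set" where
  "subspace_sum u v = {a + b | a b. a \<in> u \<and> b \<in> v}"

definition VP :: "(complex ^ 'v set) set" where
  "VP = {x. \<forall>u. u \<notin> P \<longrightarrow> x $ u = 0}"

definition diagP :: "('v set \<Rightarrow> real) \<Rightarrow> complex ^ 'v set ^ 'v set" where
  "diagP d = (\<chi> u v. if u \<in> P \<and> u = v then of_real (d u) else 0)"

definition relP :: "('v set \<Rightarrow> 'v set \<Rightarrow> bool) \<Rightarrow> complex ^ 'v set ^ 'v set" where
  "relP r = (\<chi> u v. if u \<in> P \<and> v \<in> P \<and> r u v then 1 else 0)"

definition IP :: "complex ^ 'v set ^ 'v set" where
  "IP = diagP (\<lambda>u. 1)"

definition Estar :: "nat \<Rightarrow> nat \<Rightarrow> complex ^ 'v set ^ 'v set" where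
  "Estar i j = diagP (\<lambda>u. if u \<in> Pij i j then 1 else 0)"

text \<open>
  A subspace \<open>u\<close> lies in \<open>Pij i j\<close> for exactly the pair \<open>i = dim (u \<inter> y)\<close>,
  \<open>j = dim u - dim (u \<inter> y)\<close>; these values are substituted below.  The matrices \<open>K1_inv\<close>, \<open>K2_inv\<close> are inverses
  relative to the identity \<open>IP\<close>.
\<close>

definition K1_entry :: "'v set \<Rightarrow> real" where
  "K1_entry u = real q powr (real k / 2 - real (dim (u \<inter> y)))"

definition K2_entry :: "'v set \<Rightarrow> real" where
  "K2_entry u = real q powr ((real (dim u) - real (dim (u \<inter> y))) - real h / 2)"

definition K1 :: "complex ^ 'v set ^ 'v set" where
  "K1 = diagP K1_entry"

definition K2 :: "complex ^ 'v set ^ 'v set" where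
  "K2 = diagP K2_entry"

definition K1_inv :: "complex ^ 'v set ^ 'v set" where
  "K1_inv = diagP (\<lambda>u. inverse (K1_entry u))"

definition K2_inv :: "complex ^ 'v set ^ 'v set" where
  "K2_inv = diagP (\<lambda>u. inverse (K2_entry u))"

definition L1 :: "complex ^ 'v set ^ 'v set" where
  "L1 = relP (\<lambda>u v. slash_covers v u)"

definition L2 :: "complex ^ 'v set ^ 'v set" where
  "L2 = relP (\<lambda>u v. backslash_covers v u)"

definition R1 :: "complex ^ 'v set ^ 'v set" where
  "R1 = transpose L1"

definition R2 :: "complex ^ 'v set ^ 'v set" where
  "R2 = transpose L2"

inductive_set H_alg :: "(complex ^ 'v set ^ 'v set) set" where
  gen: "A \<in> {L1, L2, R1, R2, K1, K1_inv, K2, K2_inv} \<Longrightarrow> A \<in> H_alg"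
| one: "IP \<in> H_alg"
| add: "A \<in> H_alg \<Longrightarrow> B \<in> H_alg \<Longrightarrow> A + B \<in> H_alg"
| scal: "A \<in> H_alg \<Longrightarrow> (\<chi> u v. c * A $ u $ v) \<in> H_alg"
| mult: "A \<in> H_alg \<Longrightarrow> B \<in> H_alg \<Longrightarrow> A ** B \<in> H_alg"

definition H_submodule :: "(complex ^ 'v set) set \<Rightarrow> bool" where
  "H_submodule W \<longleftrightarrow> vec.subspace W \<and> W \<subseteq> VP \<and> (\<forall>A \<in> H_alg. \<forall>w \<in> W. A *v w \<in> W)"

definition irreducible_H_module :: "(complex ^ 'v set) set \<Rightarrow> bool" where
  "irreducible_H_module W \<longleftrightarrow> H_submodule W \<and> W \<noteq> {0} \<and>
     (\<forall>W'. H_submodule W' \<and> W' \<subseteq> W \<longrightarrow> W' = {0} \<or> W' = W)"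

definition has_type :: "(complex ^ 'v set) set \<Rightarrow> int \<Rightarrow> int \<Rightarrow> int \<Rightarrow> bool" where
  "has_type W \<alpha> \<beta> \<rho> \<longleftrightarrow>
     0 \<le> \<rho> \<and> 0 \<le> \<alpha> \<and> real_of_int \<alpha> \<le> (real k - real_of_int \<rho>) / 2 \<and>
     0 \<le> \<beta> \<and> real_of_int \<beta> \<le> (real h - real_of_int \<rho>) / 2 \<and>
     (\<forall>i \<le> k. \<forall>j \<le> h. vec.dim ((\<lambda>w. Estar i j *v w) ` W) =
        (if \<alpha> \<le> int i \<and> int i \<le> int k - \<rho> - \<alpha> \<and>
            \<rho> + \<beta> \<le> int j \<and> int j \<le> int h - \<beta> then 1 else 0))"

definition F_zero :: "complex ^ 'v set ^ 'v set" where
  "F_zero = relP (\<lambda>u v. slash_covers (subspace_sum u v) u \<and> slash_covers (subspace_sum u v) v \<and>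
                        backslash_covers u (u \<inter> v) \<and> backslash_covers v (u \<inter> v))"

definition F_plus :: "complex ^ 'v set ^ 'v set" where
  "F_plus = relP (\<lambda>u v. backslash_covers (subspace_sum u v) u \<and>
                        backslash_covers (subspace_sum u v) v)"

definition F_minus :: "complex ^ 'v set ^ 'v set" where
  "F_minus = relP (\<lambda>u v. slash_covers u (u \<inter> v) \<and> slash_covers v (u \<inter> v))"

definition Omega0 :: "complex ^ 'v set ^ 'v set" where
  "Omega0 = (real q powr (- (real h + real k) / 2)) *\<^sub>R
     ((real q - 1) *\<^sub>R (F_zero ** K1_inv ** K2_inv)
      + (real q powr (real h / 2)) *\<^sub>R K1_inv
      + (real q powr (real k / 2)) *\<^sub>R K2_inv
      - K1_inv ** K2_inv)"

definition Omega1 :: "complex ^ 'v set ^ 'v set" where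
  "Omega1 = (real q powr (- real h / 2)) *\<^sub>R
     (real q *\<^sub>R (F_zero ** K2_inv)
      + (real q - 1) *\<^sub>R (F_minus ** K2_inv)
      + ((real q powr (real k / 2 + 1)) *\<^sub>R (K1 ** K2_inv)
         + (real q powr ((real h + real k) / 2 + 1)) *\<^sub>R K1_inv
         - real q *\<^sub>R K2_inv) /\<^sub>R (real q - 1))
     - (real q / (real q - 1)) *\<^sub>R IP"

definition Omega2 :: "complex ^ 'v set ^ 'v set" where
  "Omega2 = (real q powr (- real k / 2)) *\<^sub>R
     (real q *\<^sub>R (F_zero ** K1_inv)
      + (real q - 1) *\<^sub>R (F_plus ** K1_inv)
      + ((real q powr (real h / 2 + 1)) *\<^sub>R (K1_inv ** K2)
         + (real q powr ((real h + real k) / 2 + 1)) *\<^sub>R K2_inv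
         - real q *\<^sub>R K1_inv) /\<^sub>R (real q - 1))
     - (real q / (real q - 1)) *\<^sub>R IP"

end

definition q_bracket :: "nat \<Rightarrow> int \<Rightarrow> complex" where
  "q_bracket q m = (of_nat q powi m - 1) / (of_nat q - 1)"

end

theory Submission
  imports Defs
begin

text \<open>
  The products \<open>L1 R1\<close>, \<open>R1 L1\<close>, \<open>R2 L2\<close>, \<open>L2 R2\<close> connect subspaces with a common cover or a
  common subspace that they cover.  Off the diagonal each of them is \<open>F_zero\<close>, \<open>F_plus\<close>,
  \<open>F_minus\<close> or a sum of two of these: for \<open>u \<noteq> v\<close> the common cover can only be \<open>u + v\<close> and the
  subspace covered by both can only be \<open>u \<inter> v\<close>, and the submodular inequality for
  \<open>dim (u \<inter> y)\<close> says which combinations of covering types occur (lemma \<open>diamond\<close>).  On the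
  diagonal stand numbers of covers, which are Gaussian integers.  Hence \<open>F_zero\<close> is, up to
  diagonal matrices, both \<open>L1 R1 - R1 L1\<close> and \<open>R2 L2 - L2 R2\<close>.  In addition \<open>L1\<close> commutes with
  \<open>R2\<close>, \<open>L2\<close> commutes with \<open>R1\<close>, \<open>L2 L1 = q L1 L2\<close> and \<open>R1 R2 = q R2 R1\<close>.

  Having two expressions for \<open>F_zero\<close> is the point: the second one can be moved past \<open>L1\<close> and
  \<open>R1\<close> with the relations just listed, and the first one past \<open>L2\<close> and \<open>R2\<close>.  So \<open>F_zero\<close>
  commutes with the generators up to powers of \<open>q\<close> and diagonal terms, and these are exactly what
  the diagonal factors in \<open>Omega0\<close> compensate; thus \<open>Omega0\<close> commutes with all of \<open>H_alg\<close>.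
  On an irreducible module \<open>W\<close> a nonzero weight space is a line, so \<open>Omega0\<close> has an eigenvector
  there and is a scalar \<open>c\<close> on \<open>W\<close> by Schur's argument.  Then \<open>F_zero\<close> is a known scalar on each
  weight space, \<open>Omega1\<close> becomes a combination of \<open>R1 L1\<close> and a diagonal term, \<open>Omega2\<close> one of
  \<open>L2 R2\<close> and a diagonal term, and both are seen to be scalars in the same way.

  The scalars are read off at the ends of the rectangle of weights of \<open>W\<close>.  At the weight
  \<open>(\<alpha>, \<rho> + \<beta>)\<close> both \<open>L1\<close> and \<open>L2\<close> vanish, at \<open>(k - \<rho> - \<alpha>, \<rho> + \<beta>)\<close> the matrix \<open>R1\<close> vanishes.
  These two weights give two expressions for the scalar of \<open>Omega1\<close>, linear in \<open>c\<close>, and equating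
  them forces \<open>c = q^(-\<rho>)\<close>.
\<close>

lemmas mat_vec_simps = matrix_vector_right_distrib matrix_vector_mult_diff_distrib
  vector_scalar_commute vector_smult_assoc

context subspace_lattice
begin

section \<open>Counting subspaces over a finite field\<close>

sublocale fd: finite_dimensional_vector_space scale "extend_basis {}"
  by unfold_locales
    (simp_all add: independent_extend_basis span_extend_basis independent_empty
      finite_subset[OF _ finite])

lemma q_ge_2: "2 \<le> q"
proof -
  have "card {0, 1::'f} \<le> CARD('f)" by (rule card_mono) auto
  thus ?thesis by (simp add: card_field)
qed

lemma card_span_independent:
  "finite B \<Longrightarrow> independent B \<Longrightarrow> card (span B) = q ^ card B"
proof (induction B rule: finite_induct)
  case (insert b B)
  have ind: "independent B" and nb: "b \<notin> span B"
    using insert.prems insert.hyps by (simp_all add: independent_insert)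
  let ?f = "\<lambda>(c, x). scale c b + x"
  have "inj_on ?f (UNIV \<times> span B)"
  proof (rule inj_onI, clarsimp)
    fix c x d z assume *: "x \<in> span B" "z \<in> span B" "scale c b + x = scale d b + z"
    have e: "scale (c - d) b = z - x" using *(3) by (simp add: algebra_simps)
    have "c = d"
    proof (rule ccontr)
      assume "c \<noteq> d"
      have "scale (inverse (c - d)) (scale (c - d) b) \<in> span B"
        unfolding e using * by (intro span_scale span_diff)
      thus False using nb \<open>c \<noteq> d\<close> by simp
    qed
    thus "c = d \<and> x = z" using *(3) by simp
  qed
  moreover have "?f ` (UNIV \<times> span B) = span (insert b B)"
  proof (safe)
    fix c x assume "x \<in> span B"
    thus "scale c b + x \<in> span (insert b B)"
      using span_mono[of B "insert b B"] by (intro span_add span_scale) (auto intro: span_base)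
  next
    fix x assume "x \<in> span (insert b B)"
    then obtain c where "x - scale c b \<in> span B"
      unfolding span_insert by auto
    moreover have "x = ?f (c, x - scale c b)" by simp
    ultimately show "x \<in> ?f ` (UNIV \<times> span B)" by blast
  qed
  ultimately have "card (span (insert b B)) = card ((UNIV::'f set) \<times> span B)"
    by (metis card_image)
  thus ?case using insert ind by (simp add: card_cartesian_product card_field)
qed simp

lemma card_subspace:
  assumes "subspace s" shows "card s = q ^ dim s"
proof -
  obtain B where B: "B \<subseteq> s" "independent B" "s \<subseteq> span B" "card B = dim s"
    by (rule basis_exists)
  have "span B = s" using B assms span_minimal by blast
  thus ?thesis using card_span_independent[of B] B by (simp add: finite_subset[OF _ finite])
qed

lemma subspace_eqI_dim:
  "\<lbrakk>subspace u; subspace v; u \<subseteq> v; dim v \<le> dim u\<rbrakk> \<Longrightarrow> u = v"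
  by (rule fd.subspace_dim_equal)

lemma dim_sum_inter:
  assumes "subspace u" "subspace v"
  shows "dim (subspace_sum u v) + dim (u \<inter> v) = dim u + dim v"
  unfolding subspace_sum_def using fd.dim_sums_Int[OF assms] by simp

lemma subspace_subspace_sum:
  "\<lbrakk>subspace u; subspace v\<rbrakk> \<Longrightarrow> subspace (subspace_sum u v)"
  unfolding subspace_sum_def by (rule subspace_sums)

lemma subspace_sum_upper:
  assumes "subspace u" "subspace v"
  shows "u \<subseteq> subspace_sum u v" "v \<subseteq> subspace_sum u v"
  unfolding subspace_sum_def using subspace_0[OF assms(1)] subspace_0[OF assms(2)]
  by (force, force)

lemma subspace_sum_least:
  "\<lbrakk>subspace w; u \<subseteq> w; v \<subseteq> w\<rbrakk> \<Longrightarrow> subspace_sum u v \<subseteq> w"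
  unfolding subspace_sum_def by (auto intro: subspace_add)

lemma q_bracket_nat: "q_bracket q (int n) = (of_nat q ^ n - 1) / (of_nat q - 1)"
  by (simp add: q_bracket_def)

lemma of_nat_q_nontrivial: "(of_nat q :: complex) \<noteq> 0" "(of_nat q :: complex) \<noteq> 1"
  "(of_nat q :: complex) - 1 \<noteq> 0"
  using q_ge_2 of_nat_eq_iff[where 'a=complex, of q 1] by auto

text \<open>
  The sets \<open>z - u\<close>, for \<open>z\<close> a cover of \<open>u\<close> inside \<open>s\<close>, partition \<open>s - u\<close>: a vector \<open>a\<close> outside
  \<open>u\<close> lies in the single cover spanned by \<open>u\<close> and \<open>a\<close>.
\<close>

lemma card_covers_within:
  assumes u: "subspace u" and s: "subspace s" and us: "u \<subseteq> s"
  shows "of_nat (card {z \<in> P. covers z u \<and> z \<subseteq> s}) = q_bracket q (int (dim s) - int (dim u))"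
proof -
  let ?Z = "{z \<in> P. covers z u \<and> z \<subseteq> s}"
  have Un: "s - u = (\<Union>z\<in>?Z. z - u)"
  proof (safe)
    fix a assume a: "a \<in> s" "a \<notin> u"
    have nu: "a \<notin> span u" using a u by (metis span_eq_iff)
    have "dim (span (insert a u)) = dim u + 1" using nu by (simp add: fd.dim_insert)
    moreover have "span (insert a u) \<subseteq> s" using a us s by (intro span_minimal) auto
    moreover have "insert a u \<subseteq> span (insert a u)" by (rule span_superset)
    ultimately have "span (insert a u) \<in> ?Z" "a \<in> span (insert a u) - u"
      using a unfolding P_def covers_def by auto
    thus "a \<in> (\<Union>z\<in>?Z. z - u)" by blast
  qed auto
  have disj: "z = w" if "z \<in> ?Z" "w \<in> ?Z" "a \<in> z - u" "a \<in> w - u" for z w a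
  proof -
    have nu: "a \<notin> span u" using that u by (metis DiffD2 span_eq_iff)
    have d: "dim (span (insert a u)) = dim u + 1" using nu by (simp add: fd.dim_insert)
    have "span (insert a u) = x" if "x \<in> ?Z" "a \<in> x" for x
      using that d by (intro subspace_eqI_dim span_minimal) (auto simp: P_def covers_def)
    thus ?thesis using that by blast
  qed
  have "card (s - u) = (\<Sum>z\<in>?Z. card (z - u))"
    unfolding Un by (rule card_UN_disjoint) (simp, simp, use disj in blast)
  also have "\<dots> = (\<Sum>z\<in>?Z. q ^ (dim u + 1) - q ^ dim u)"
  proof (rule sum.cong[OF refl])
    fix z assume "z \<in> ?Z"
    hence z: "subspace z" "u \<subseteq> z" "dim z = dim u + 1" by (auto simp: P_def covers_def)
    thus "card (z - u) = q ^ (dim u + 1) - q ^ dim u"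
      using u by (simp add: card_Diff_subset finite_subset[OF _ finite] card_subspace)
  qed
  finally have "card (s - u) = card ?Z * (q ^ (dim u + 1) - q ^ dim u)" by simp
  moreover have "card (s - u) = q ^ dim s - q ^ dim u"
    using u s us by (simp add: card_Diff_subset finite_subset[OF _ finite] card_subspace)
  moreover obtain m where m: "dim s = dim u + m"
    using fd.dim_subset[OF us] nat_le_iff_add by blast
  ultimately have "q ^ dim u * (q ^ m - 1) = q ^ dim u * (card ?Z * (q - 1))"
    by (simp add: power_add algebra_simps diff_mult_distrib)
  hence "q ^ m - 1 = card ?Z * (q - 1)" using q_ge_2 by simp
  hence "of_nat (q ^ m - 1) = (of_nat (card ?Z * (q - 1)) :: complex)" by simp
  hence "of_nat q ^ m - 1 = (of_nat (card ?Z) * (of_nat q - 1) :: complex)"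
    using q_ge_2 by (simp add: of_nat_diff)
  thus ?thesis using of_nat_q_nontrivial unfolding m by (simp add: q_bracket_nat field_simps)
qed

lemma q_bracket_nat_nonzero: "0 < n \<Longrightarrow> q_bracket q (int n) \<noteq> 0"
proof -
  assume "0 < n"
  hence "q ^ n \<noteq> 1" using q_ge_2 by simp
  hence "(of_nat (q ^ n) :: complex) \<noteq> of_nat 1" unfolding of_nat_eq_iff .
  thus ?thesis using of_nat_q_nontrivial by (simp add: q_bracket_nat)
qed

text \<open>
  Counting pairs \<open>t \<subset> w \<subseteq> z \<subset> u\<close> with \<open>w\<close> covering \<open>t\<close> and \<open>u\<close> covering \<open>z\<close> in two ways shows, by
  induction on the codimension \<open>n + 1\<close> of \<open>t\<close>, that there are as many hyperplanes \<open>z\<close> as covers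
  \<open>w\<close>; this avoids duality.  The induction divides by \<open>[n]\<close>, so codimension one is separate.
\<close>

lemma card_hyperplanes_above:
  assumes u: "subspace u"
  shows "\<lbrakk>subspace t; t \<subseteq> u\<rbrakk> \<Longrightarrow>
    of_nat (card {z \<in> P. covers u z \<and> t \<subseteq> z}) = q_bracket q (int (dim u) - int (dim t))"
proof (induction "dim u - dim t" arbitrary: t)
  case 0
  hence "dim u = dim t" using fd.dim_subset[of t u] by simp
  moreover have "\<not> (covers u z \<and> t \<subseteq> z)" for z
    using fd.dim_subset[of t z] \<open>dim u = dim t\<close> by (auto simp: covers_def)
  ultimately show ?case by (simp add: q_bracket_def)
next
  case (Suc n)
  hence d: "dim u = dim t + Suc n" by simp
  let ?Z = "{z \<in> P. covers u z \<and> t \<subseteq> z}" and ?Y = "{w \<in> P. covers w t \<and> w \<subseteq> u}"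
  show ?case
  proof (cases "n = 0")
    case True
    have "z = t" if "z \<in> ?Z" for z
      using that Suc.prems d True subspace_eqI_dim[of t z] by (simp add: covers_def P_def)
    moreover have "t \<in> ?Z" using Suc.prems d True by (simp add: covers_def P_def)
    ultimately have "?Z = {t}" by blast
    thus ?thesis using d True of_nat_q_nontrivial by (simp add: q_bracket_def)
  next
    case False
    have up: "of_nat (card {w. w \<in> ?Y \<and> w \<subseteq> z}) = q_bracket q (int n)" if "z \<in> ?Z" for z
    proof -
      have "{w. w \<in> ?Y \<and> w \<subseteq> z} = {w \<in> P. covers w t \<and> w \<subseteq> z}"
        using that by (auto simp: covers_def)
      moreover have "int (dim z) - int (dim t) = int n" using that d by (auto simp: covers_def)
      ultimately show ?thesis
        using card_covers_within[of t z] that Suc.prems by (simp add: P_def)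
    qed
    have down: "of_nat (card {z. z \<in> ?Z \<and> w \<subseteq> z}) = q_bracket q (int n)" if "w \<in> ?Y" for w
    proof -
      have "{z. z \<in> ?Z \<and> w \<subseteq> z} = {z \<in> P. covers u z \<and> w \<subseteq> z}"
        using that by (auto simp: covers_def)
      moreover have n: "n = dim u - dim w" and "int (dim u) - int (dim w) = int n"
        using that d by (auto simp: covers_def)
      moreover have w: "subspace w" "w \<subseteq> u" using that by (auto simp: P_def)
      ultimately show ?thesis using Suc.hyps(1)[OF n w] by metis
    qed
    have "(\<Sum>z\<in>?Z. \<Sum>w | w \<in> ?Y \<and> w \<subseteq> z. 1::complex) = (\<Sum>w\<in>?Y. \<Sum>z | z \<in> ?Z \<and> w \<subseteq> z. 1)"
      by (rule sum.swap_restrict) auto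
    hence "of_nat (card ?Z) * q_bracket q (int n) = of_nat (card ?Y) * q_bracket q (int n)"
      using up down by simp
    hence "(of_nat (card ?Z) :: complex) = of_nat (card ?Y)"
      using q_bracket_nat_nonzero False by simp
    thus ?thesis using card_covers_within[of t u] Suc.prems u by simp
  qed
qed

section \<open>The two kinds of covering\<close>

lemma dim_y_covers:
  assumes "u \<in> P" "v \<in> P" "covers v u"
  shows "dim (u \<inter> y) \<le> dim (v \<inter> y)" "dim (v \<inter> y) \<le> dim (u \<inter> y) + 1"
proof -
  have s: "subspace u" "subspace v" "subspace (v \<inter> y)" and uv: "u \<subseteq> v" "dim v = dim u + 1"
    using assms subspace_y by (auto simp: P_def covers_def intro: subspace_inter)
  show "dim (u \<inter> y) \<le> dim (v \<inter> y)" using uv by (intro fd.dim_subset) auto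
  have "subspace_sum u (v \<inter> y) \<subseteq> v" using s uv by (intro subspace_sum_least) auto
  hence "dim (subspace_sum u (v \<inter> y)) \<le> dim u + 1" using fd.dim_subset uv by metis
  moreover have "u \<inter> (v \<inter> y) = u \<inter> y" using uv by auto
  ultimately show "dim (v \<inter> y) \<le> dim (u \<inter> y) + 1"
    using dim_sum_inter[OF s(1,3)] by simp
qed

text \<open>
  Together with \<open>dim_y_covers\<close> this inequality is all that the case distinctions between
  \<open>slash_covers\<close> and \<open>backslash_covers\<close> need.
\<close>

lemma dim_y_submodular:
  assumes "u \<in> P" "v \<in> P"
  shows "dim (u \<inter> y) + dim (v \<inter> y) \<le> dim (u \<inter> v \<inter> y) + dim (subspace_sum u v \<inter> y)"
proof -
  have s: "subspace u" "subspace v" "subspace (u \<inter> y)" "subspace (v \<inter> y)"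
    using assms subspace_y by (auto simp: P_def intro: subspace_inter)
  have "subspace_sum (u \<inter> y) (v \<inter> y) \<subseteq> subspace_sum u v \<inter> y"
    using s subspace_y subspace_sum_upper[OF s(1,2)]
    by (intro subspace_sum_least subspace_inter subspace_subspace_sum) auto
  hence "dim (subspace_sum (u \<inter> y) (v \<inter> y)) \<le> dim (subspace_sum u v \<inter> y)"
    by (rule fd.dim_subset)
  moreover have "(u \<inter> y) \<inter> (v \<inter> y) = u \<inter> v \<inter> y" by auto
  ultimately show ?thesis using dim_sum_inter[OF s(3,4)] by simp
qed

lemma covers_both_eq_sum:
  assumes "u \<in> P" "v \<in> P" "z \<in> P" "u \<noteq> v" "covers z u" "covers z v"
  shows "z = subspace_sum u v" "covers u (u \<inter> v)" "covers v (u \<inter> v)"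
proof -
  have s: "subspace u" "subspace v" "subspace z" "u \<subseteq> z" "v \<subseteq> z"
    "dim z = dim u + 1" "dim v = dim u"
    using assms by (auto simp: P_def covers_def)
  let ?s = "subspace_sum u v"
  have sub: "u \<subseteq> ?s" "v \<subseteq> ?s" "subspace ?s" "?s \<subseteq> z"
    using s subspace_sum_upper subspace_subspace_sum subspace_sum_least by auto
  have "\<not> dim ?s \<le> dim u"
  proof
    assume "dim ?s \<le> dim u"
    hence "u = ?s" "v = ?s" using s sub subspace_eqI_dim[of u ?s] subspace_eqI_dim[of v ?s] by simp_all
    thus False using assms by simp
  qed
  thus z: "z = ?s" using s sub subspace_eqI_dim[of ?s z] by simp
  have "dim (u \<inter> v) + 1 = dim u" using dim_sum_inter[OF s(1,2)] s z by simp
  thus "covers u (u \<inter> v)" "covers v (u \<inter> v)" using s by (auto simp: covers_def)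
qed

lemma covered_by_both_eq_inter:
  assumes "u \<in> P" "v \<in> P" "z \<in> P" "u \<noteq> v" "covers u z" "covers v z"
  shows "z = u \<inter> v" "covers (subspace_sum u v) u" "covers (subspace_sum u v) v"
proof -
  have s: "subspace u" "subspace v" "subspace z" "z \<subseteq> u" "z \<subseteq> v"
    "dim u = dim z + 1" "dim v = dim z + 1" "subspace (u \<inter> v)"
    using assms by (auto simp: P_def covers_def intro: subspace_inter)
  have "\<not> dim u \<le> dim (u \<inter> v)"
  proof
    assume "dim u \<le> dim (u \<inter> v)"
    hence "dim v \<le> dim (u \<inter> v)" "dim u \<le> dim (u \<inter> v)" using s by simp_all
    hence "u \<inter> v = u" "u \<inter> v = v"
      using subspace_eqI_dim[OF s(8) s(1)] subspace_eqI_dim[OF s(8) s(2)] by blast+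
    thus False using assms by simp
  qed
  thus z: "z = u \<inter> v" using s subspace_eqI_dim[of z "u \<inter> v"] by simp
  have "dim (subspace_sum u v) = dim u + 1" using dim_sum_inter[OF s(1,2)] s z by simp
  thus "covers (subspace_sum u v) u" "covers (subspace_sum u v) v"
    using s subspace_sum_upper by (auto simp: covers_def)
qed

lemma P_closed:
  assumes "u \<in> P" "v \<in> P" shows "subspace_sum u v \<in> P" "u \<inter> v \<in> P"
  using assms by (auto simp: P_def intro: subspace_inter subspace_subspace_sum)

lemma card_common_upper:
  assumes "u \<in> P" "v \<in> P" "u \<noteq> v" "\<And>z. Q z \<Longrightarrow> covers z u \<and> covers z v"
  shows "card {z \<in> P. Q z} = of_bool (Q (subspace_sum u v))"
proof -
  have "{z \<in> P. Q z} = (if Q (subspace_sum u v) then {subspace_sum u v} else {})"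
    using assms covers_both_eq_sum(1)[OF assms(1,2) _ assms(3)] P_closed by auto
  thus ?thesis by simp
qed

lemma card_common_lower:
  assumes "u \<in> P" "v \<in> P" "u \<noteq> v" "\<And>z. Q z \<Longrightarrow> covers u z \<and> covers v z"
  shows "card {z \<in> P. Q z} = of_bool (Q (u \<inter> v))"
proof -
  have "{z \<in> P. Q z} = (if Q (u \<inter> v) then {u \<inter> v} else {})"
    using assms covered_by_both_eq_inter(1)[OF assms(1,2) _ assms(3)] P_closed by auto
  thus ?thesis by simp
qed

text \<open>
  Write \<open>i\<close> for the dimension of the intersection with \<open>y\<close>.  Each edge of the diamond
  \<open>m, u, v, s\<close> raises \<open>i\<close> by 0 or 1 and \<open>i u + i v \<le> i m + i s\<close>, which leaves these
  possibilities: the first two claims split the matrices \<open>L1 R1\<close> and \<open>R2 L2\<close>, the third one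
  compares \<open>L1 R2\<close> with \<open>R2 L1\<close>.
\<close>

lemma diamond:
  assumes "u \<in> P" "v \<in> P" "u \<noteq> v"
  defines "s \<equiv> subspace_sum u v" and "m \<equiv> u \<inter> v"
  shows "slash_covers s u \<and> slash_covers s v \<longleftrightarrow>
      (slash_covers s u \<and> slash_covers s v \<and> backslash_covers u m \<and> backslash_covers v m)
      \<or> (slash_covers u m \<and> slash_covers v m)"
    and "backslash_covers u m \<and> backslash_covers v m \<longleftrightarrow>
      (slash_covers s u \<and> slash_covers s v \<and> backslash_covers u m \<and> backslash_covers v m)
      \<or> (backslash_covers s u \<and> backslash_covers s v)"
    and "slash_covers s u \<and> backslash_covers s v \<longleftrightarrow> backslash_covers u m \<and> slash_covers v m"
proof -
  have c: "covers s u \<and> covers s v \<longleftrightarrow> covers u m \<and> covers v m"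
    unfolding s_def m_def
    using covers_both_eq_sum(2,3)[OF assms(1,2) _ assms(3)] P_closed[OF assms(1,2)]
      covered_by_both_eq_inter(2,3)[OF assms(1,2) _ assms(3)] by blast
  have sub: "dim (u \<inter> y) + dim (v \<inter> y) \<le> dim (m \<inter> y) + dim (s \<inter> y)"
    unfolding s_def m_def using dim_y_submodular[OF assms(1,2)] .
  have P: "s \<in> P" "m \<in> P" unfolding s_def m_def using P_closed[OF assms(1,2)] .
  have inc: "dim (u \<inter> y) \<le> dim (s \<inter> y) \<and> dim (s \<inter> y) \<le> dim (u \<inter> y) + 1 \<and>
      dim (v \<inter> y) \<le> dim (s \<inter> y) \<and> dim (s \<inter> y) \<le> dim (v \<inter> y) + 1 \<and>
      dim (m \<inter> y) \<le> dim (u \<inter> y) \<and> dim (u \<inter> y) \<le> dim (m \<inter> y) + 1 \<and>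
      dim (m \<inter> y) \<le> dim (v \<inter> y) \<and> dim (v \<inter> y) \<le> dim (m \<inter> y) + 1"
    if "covers u m" "covers v m"
    using dim_y_covers[OF assms(1) P(1)] dim_y_covers[OF assms(2) P(1)]
      dim_y_covers[OF P(2) assms(1)] dim_y_covers[OF P(2) assms(2)] that c by blast
  show "slash_covers s u \<and> slash_covers s v \<longleftrightarrow>
      (slash_covers s u \<and> slash_covers s v \<and> backslash_covers u m \<and> backslash_covers v m)
      \<or> (slash_covers u m \<and> slash_covers v m)"
    and "backslash_covers u m \<and> backslash_covers v m \<longleftrightarrow>
      (slash_covers s u \<and> slash_covers s v \<and> backslash_covers u m \<and> backslash_covers v m)
      \<or> (backslash_covers s u \<and> backslash_covers s v)"
    and "slash_covers s u \<and> backslash_covers s v \<longleftrightarrow> backslash_covers u m \<and> slash_covers v m"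
    unfolding slash_covers_def backslash_covers_def
    by (cases "covers u m \<and> covers v m"; use c inc sub in \<open>simp; linarith\<close>)+
qed

lemma slash_or_backslash:
  assumes "u \<in> P" "v \<in> P" 
  shows "covers v u \<longleftrightarrow> slash_covers v u \<or> backslash_covers v u"
    and "\<not> (slash_covers v u \<and> backslash_covers v u)"
  using dim_y_covers[OF assms] by (auto simp: slash_covers_def backslash_covers_def)

text \<open>
  A cover of \<open>u\<close> is a slash cover if and only if it lies in \<open>u + y\<close>, so this is a count of covers
  within \<open>u + y\<close>.
\<close>

lemma card_slash_covers:
  assumes "u \<in> P"
  shows "of_nat (card {z \<in> P. slash_covers z u}) = q_bracket q (int k - int (dim (u \<inter> y)))"
proof -
  have su: "subspace u" using assms by (simp add: P_def)
  let ?s = "subspace_sum u y"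
  have s: "subspace ?s" "u \<subseteq> ?s" "y \<subseteq> ?s"
    using su subspace_y subspace_sum_upper subspace_subspace_sum by auto
  have "slash_covers z u \<longleftrightarrow> covers z u \<and> z \<subseteq> ?s" if z: "z \<in> P" for z
  proof (cases "covers z u")
    case True
    hence zu: "subspace z" "u \<subseteq> z" "dim z = dim u + 1" using z by (auto simp: P_def covers_def)
    let ?t = "subspace_sum z y"
    have t: "subspace ?t" "z \<subseteq> ?t" "y \<subseteq> ?t"
      using zu subspace_y subspace_sum_upper subspace_subspace_sum by auto
    have st: "?s \<subseteq> ?t" using t zu by (intro subspace_sum_least) auto
    have ds: "dim ?s + dim (u \<inter> y) = dim u + k" "dim ?t + dim (z \<inter> y) = dim z + k"
      using dim_sum_inter[OF su subspace_y] dim_sum_inter[OF zu(1) subspace_y] dim_y by auto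
    have "z \<subseteq> ?s \<longleftrightarrow> dim ?t \<le> dim ?s"
    proof
      assume "z \<subseteq> ?s"
      hence "?t \<subseteq> ?s" using s by (intro subspace_sum_least) auto
      thus "dim ?t \<le> dim ?s" by (rule fd.dim_subset)
    next
      assume "dim ?t \<le> dim ?s"
      hence "?s = ?t" using s t st by (intro subspace_eqI_dim)
      thus "z \<subseteq> ?s" using t by simp
    qed
    thus ?thesis using True ds zu dim_y_covers[OF assms z True] by (auto simp: slash_covers_def)
  qed (simp add: slash_covers_def)
  hence "{z \<in> P. slash_covers z u} = {z \<in> P. covers z u \<and> z \<subseteq> ?s}" by auto
  moreover have "int (dim ?s) - int (dim u) = int k - int (dim (u \<inter> y))"
    using dim_sum_inter[OF su subspace_y] dim_y by simp
  ultimately show ?thesis using card_covers_within[OF su s(1,2)] by simp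
qed

lemma card_backslash_covers:
  assumes "u \<in> P"
  shows "of_nat (card {z \<in> P. backslash_covers z u}) =
    q_bracket q (int h + int k - int (dim u)) - q_bracket q (int k - int (dim (u \<inter> y)))"
proof -
  have "{z \<in> P. covers z u \<and> z \<subseteq> UNIV} =
      {z \<in> P. slash_covers z u} \<union> {z \<in> P. backslash_covers z u}"
    using slash_or_backslash(1)[OF assms] by auto
  moreover have "{z \<in> P. slash_covers z u} \<inter> {z \<in> P. backslash_covers z u} = {}"
    using slash_or_backslash(2)[OF assms] by auto
  ultimately have "card {z \<in> P. covers z u \<and> z \<subseteq> UNIV} =
      card {z \<in> P. slash_covers z u} + card {z \<in> P. backslash_covers z u}"
    by (simp only: card_Un_disjoint[OF finite finite])
  thus ?thesis
    using card_covers_within[of u UNIV] card_slash_covers[OF assms] assms dim_space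
    by (simp add: P_def subspace_UNIV eq_diff_eq add.commute del: fd.dim_UNIV)
qed

text \<open>
  The backslash-covered subspaces of \<open>u\<close> are the hyperplanes that contain \<open>u \<inter> y\<close>.
\<close>

lemma card_backslash_covered:
  assumes "u \<in> P"
  shows "of_nat (card {z \<in> P. backslash_covers u z}) =
    q_bracket q (int (dim u) - int (dim (u \<inter> y)))"
proof -
  have s: "subspace u" "subspace (u \<inter> y)"
    using assms subspace_y by (auto simp: P_def intro: subspace_inter)
  have "backslash_covers u z \<longleftrightarrow> covers u z \<and> u \<inter> y \<subseteq> z" if z: "z \<in> P" for z
  proof (cases "covers u z")
    case True
    hence zu: "subspace (z \<inter> y)" "z \<subseteq> u"
      using z subspace_y by (auto simp: P_def covers_def intro: subspace_inter)
    have "u \<inter> y \<subseteq> z \<longleftrightarrow> z \<inter> y = u \<inter> y" using zu by auto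
    also have "\<dots> \<longleftrightarrow> dim (u \<inter> y) = dim (z \<inter> y)"
    proof
      assume "dim (u \<inter> y) = dim (z \<inter> y)"
      thus "z \<inter> y = u \<inter> y" using zu s by (intro subspace_eqI_dim) auto
    qed simp
    finally show ?thesis using True by (simp add: backslash_covers_def)
  qed (simp add: backslash_covers_def)
  hence "{z \<in> P. backslash_covers u z} = {z \<in> P. covers u z \<and> u \<inter> y \<subseteq> z}" by auto
  thus ?thesis using card_hyperplanes_above[OF s] by simp
qed

lemma card_slash_covered:
  assumes "u \<in> P"
  shows "of_nat (card {z \<in> P. slash_covers u z}) =
    q_bracket q (int (dim u)) - q_bracket q (int (dim u) - int (dim (u \<inter> y)))"
proof -
  have su: "subspace u" and z: "{0} \<subseteq> u" using assms subspace_0 by (auto simp: P_def)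
  have "covers u z \<and> {0} \<subseteq> z \<longleftrightarrow> slash_covers u z \<or> backslash_covers u z" if "z \<in> P" for z
    using slash_or_backslash(1)[OF that assms] that subspace_0 by (auto simp: P_def)
  hence "{z \<in> P. covers u z \<and> {0} \<subseteq> z} =
      {z \<in> P. slash_covers u z} \<union> {z \<in> P. backslash_covers u z}" by auto
  moreover have "{z \<in> P. slash_covers u z} \<inter> {z \<in> P. backslash_covers u z} = {}"
    using slash_or_backslash(2)[OF _ assms] by auto
  ultimately have "card {z \<in> P. covers u z \<and> {0} \<subseteq> z} =
      card {z \<in> P. slash_covers u z} + card {z \<in> P. backslash_covers u z}"
    by (simp only: card_Un_disjoint[OF finite finite])
  thus ?thesis
    using card_hyperplanes_above[OF su _ z] card_backslash_covered[OF assms]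
    by (simp add: subspace_single_0 eq_diff_eq)
qed

text \<open>
  Suppose that the interval from \<open>u\<close> to \<open>v\<close> has length 2 and the intersection with \<open>y\<close> grows by 1.
  It has \<open>q + 1\<close> intermediate subspaces, and \<open>u + (v \<inter> y)\<close> is the only one where the growth takes
  place in the first step; this ratio \<open>q : 1\<close> is the origin of \<open>L2 L1 = q L1 L2\<close>.
\<close>

lemma card_mixed_intermediate:
  assumes u: "u \<in> P" and v: "v \<in> P"
  shows "card {z \<in> P. backslash_covers z u \<and> slash_covers v z} =
    q * card {z \<in> P. slash_covers z u \<and> backslash_covers v z}"
    (is "card ?A = q * card ?B")
proof (cases "u \<subseteq> v \<and> dim v = dim u + 2 \<and> dim (v \<inter> y) = dim (u \<inter> y) + 1")
  case False
  have "z \<notin> ?A" "z \<notin> ?B" for z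
    using False by (auto simp: slash_covers_def backslash_covers_def covers_def)
  hence "?A = {}" "?B = {}" by blast+
  thus ?thesis by (metis card.empty mult_0_right)
next
  case True
  have s: "subspace u" "subspace v" "subspace (v \<inter> y)"
    using u v subspace_y by (auto simp: P_def intro: subspace_inter)
  have uv: "u \<subseteq> v" "dim v = dim u + 2" "dim (v \<inter> y) = dim (u \<inter> y) + 1" using True by auto
  let ?t = "subspace_sum u (v \<inter> y)"
  have t: "subspace ?t" "u \<subseteq> ?t" "v \<inter> y \<subseteq> ?t" "?t \<subseteq> v"
    using s uv subspace_sum_upper[OF s(1,3)]
    by (auto intro: subspace_subspace_sum subsetD[OF subspace_sum_least])
  have "u \<inter> (v \<inter> y) = u \<inter> y" using uv by auto
  hence dt: "dim ?t = dim u + 1" using dim_sum_inter[OF s(1,3)] uv by simp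
  have ty: "?t \<inter> y = v \<inter> y" using t by auto
  have "?B = {?t}"
  proof (intro equalityI subsetI)
    fix z assume "z \<in> ?B"
    hence z: "subspace z" "subspace (z \<inter> y)" "u \<subseteq> z" "z \<subseteq> v" "dim z = dim u + 1"
      "dim (z \<inter> y) = dim (v \<inter> y)"
      using subspace_y
      by (auto simp: P_def slash_covers_def backslash_covers_def covers_def intro: subspace_inter)
    have "z \<inter> y = v \<inter> y" using z s by (intro subspace_eqI_dim) auto
    hence "?t \<subseteq> z" using z by (intro subspace_sum_least) auto
    thus "z \<in> {?t}" using z t dt subspace_eqI_dim[of ?t z] by simp
  next
    fix z assume "z \<in> {?t}"
    thus "z \<in> ?B" using t dt ty uv
      by (auto simp: P_def slash_covers_def backslash_covers_def covers_def)
  qed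
  hence B: "card ?B = 1" by simp
  have "{z \<in> P. covers z u \<and> z \<subseteq> v} = ?A \<union> ?B"
  proof (intro equalityI subsetI)
    fix z assume z: "z \<in> {z \<in> P. covers z u \<and> z \<subseteq> v}"
    hence "covers v z" using uv by (auto simp: covers_def)
    thus "z \<in> ?A \<union> ?B"
      using z uv(3) dim_y_covers[OF u, of z] dim_y_covers[OF _ v, of z]
      unfolding slash_covers_def backslash_covers_def by (simp, linarith)
  qed (auto simp: slash_covers_def backslash_covers_def covers_def)
  moreover have "?A \<inter> ?B = {}" by (auto simp: slash_covers_def backslash_covers_def)
  ultimately have "card {z \<in> P. covers z u \<and> z \<subseteq> v} = card ?A + 1"
    using B by (simp only: card_Un_disjoint[OF finite finite])
  moreover have "of_nat (card {z \<in> P. covers z u \<and> z \<subseteq> v}) = (of_nat (q + 1) :: complex)"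
  proof -
    have "int (dim v) - int (dim u) = int 2" using uv by simp
    thus ?thesis using card_covers_within[OF s(1,2) uv(1)] of_nat_q_nontrivial
      by (simp only: q_bracket_nat) (simp add: field_simps power2_eq_square)
  qed
  ultimately show ?thesis using B by (simp only: of_nat_eq_iff)
qed

section \<open>Relations between the generators and the diamond matrices\<close>

text \<open>
  A complex version of \<open>diagP\<close>, so that Gaussian integers, which are complex numbers here, may
  stand on the diagonal.
\<close>

definition cdiag :: "('v set \<Rightarrow> complex) \<Rightarrow> complex ^ 'v set ^ 'v set" where
  "cdiag d = (\<chi> u v. if u \<in> P \<and> u = v then d u else 0)"

lemma diagP_eq_cdiag: "diagP d = cdiag (\<lambda>u. of_real (d u))"
  by (simp add: diagP_def cdiag_def)

lemma relP_nth: "relP r $ u $ v = of_bool (u \<in> P \<and> v \<in> P \<and> r u v)"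
  by (simp add: relP_def)

lemma cdiag_nth: "cdiag d $ u $ v = (if u = v then of_bool (u \<in> P) * d u else 0)"
  by (simp add: cdiag_def)

lemma relP_mult_nth:
  "(relP r ** relP s) $ u $ v =
    of_bool (u \<in> P \<and> v \<in> P) * of_nat (card {z \<in> P. r u z \<and> s z v})"
proof -
  have "{z \<in> P. r u z \<and> z \<in> P \<and> s z v} = {z \<in> P. r u z \<and> s z v}" by auto
  thus ?thesis
    by (cases "u \<in> P \<and> v \<in> P")
      (auto simp: matrix_matrix_mult_def relP_nth simp flip: of_bool_conj)
qed

lemma of_bool_eq_add:
  "\<lbrakk>S \<longleftrightarrow> A \<or> B; \<not> (A \<and> B)\<rbrakk> \<Longrightarrow> (of_bool S :: complex) = of_bool A + of_bool B"
  by auto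

lemma R1_relP: "R1 = relP (\<lambda>u v. slash_covers u v)"
  and R2_relP: "R2 = relP (\<lambda>u v. backslash_covers u v)"
  by (auto simp: R1_def R2_def L1_def L2_def relP_def transpose_def vec_eq_iff)

lemma not_covers_refl: "\<not> slash_covers u u" "\<not> backslash_covers u u"
  by (auto simp: slash_covers_def backslash_covers_def covers_def)

lemma subspace_sum_refl: "u \<in> P \<Longrightarrow> subspace_sum u u = u"
  using subspace_sum_upper[of u u] subspace_sum_least[of u u u] by (auto simp: P_def)

text \<open>
  For \<open>u \<noteq> v\<close> the entry of each product of a raising and a lowering matrix is 0 or 1, decided by the
  covering types around \<open>u + v\<close> or \<open>u \<inter> v\<close>; for \<open>u = v\<close> it counts covers or covered subspaces.
\<close>

lemma L1_R1_matrix: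
  "L1 ** R1 = F_zero + F_minus + cdiag (\<lambda>u. q_bracket q (int k - int (dim (u \<inter> y))))"
proof -
  have "(L1 ** R1) $ u $ v =
      (F_zero + F_minus + cdiag (\<lambda>u. q_bracket q (int k - int (dim (u \<inter> y))))) $ u $ v" for u v
  proof (cases "u \<in> P \<and> v \<in> P \<and> u \<noteq> v")
    case True
    have "card {z \<in> P. slash_covers z u \<and> slash_covers z v} = of_bool
        (slash_covers (subspace_sum u v) u \<and> slash_covers (subspace_sum u v) v)"
      using True by (intro card_common_upper) (auto simp: slash_covers_def)
    moreover have "(of_bool (slash_covers (subspace_sum u v) u \<and> slash_covers (subspace_sum u v) v) :: complex)
      = of_bool (slash_covers (subspace_sum u v) u \<and> slash_covers (subspace_sum u v) v
        \<and> backslash_covers u (u \<inter> v) \<and> backslash_covers v (u \<inter> v))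
      + of_bool (slash_covers u (u \<inter> v) \<and> slash_covers v (u \<inter> v))"
      by (rule of_bool_eq_add, rule diamond(1)) (use True in \<open>auto simp: slash_covers_def backslash_covers_def\<close>)
    ultimately show ?thesis using True
      by (simp only: L1_def R1_relP relP_mult_nth F_zero_def F_minus_def F_plus_def
          vector_add_component relP_nth cdiag_nth) simp
  next
    case False
    thus ?thesis
      using card_slash_covers[of u]
      by (auto simp: L1_def R1_relP relP_mult_nth F_zero_def F_minus_def relP_nth cdiag_nth
          not_covers_refl subspace_sum_refl)
  qed
  thus ?thesis by (simp add: vec_eq_iff)
qed

lemma R1_L1_matrix:
  "R1 ** L1 = F_minus + cdiag (\<lambda>u. q_bracket q (int (dim u))
      - q_bracket q (int (dim u) - int (dim (u \<inter> y))))" (is "_ = ?M")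
proof -
  have "(R1 ** L1) $ u $ v = ?M $ u $ v" for u v
  proof (cases "u \<in> P \<and> v \<in> P \<and> u \<noteq> v")
    case True
    have "card {z \<in> P. slash_covers u z \<and> slash_covers v z} = of_bool
        (slash_covers u (u \<inter> v) \<and> slash_covers v (u \<inter> v))"
      using True by (intro card_common_lower) (auto simp: slash_covers_def)
    thus ?thesis using True
      by (simp add: L1_def R1_relP relP_mult_nth F_minus_def relP_nth cdiag_nth)
  next
    case False
    thus ?thesis
      using card_slash_covered[of u]
      by (auto simp: L1_def R1_relP relP_mult_nth F_minus_def relP_nth cdiag_nth
          not_covers_refl)
  qed
  thus ?thesis by (simp add: vec_eq_iff)
qed

lemma R2_L2_matrix:
  "R2 ** L2 = F_zero + F_plus + cdiag (\<lambda>u. q_bracket q (int (dim u) - int (dim (u \<inter> y))))"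
    (is "_ = ?M")
proof -
  have "(R2 ** L2) $ u $ v = ?M $ u $ v" for u v
  proof (cases "u \<in> P \<and> v \<in> P \<and> u \<noteq> v")
    case True
    have "card {z \<in> P. backslash_covers u z \<and> backslash_covers v z} = of_bool
        (backslash_covers u (u \<inter> v) \<and> backslash_covers v (u \<inter> v))"
      using True by (intro card_common_lower) (auto simp: backslash_covers_def)
    moreover have "(of_bool (backslash_covers u (u \<inter> v) \<and> backslash_covers v (u \<inter> v)) :: complex)
      = of_bool (slash_covers (subspace_sum u v) u \<and> slash_covers (subspace_sum u v) v
        \<and> backslash_covers u (u \<inter> v) \<and> backslash_covers v (u \<inter> v))
      + of_bool (backslash_covers (subspace_sum u v) u \<and> backslash_covers (subspace_sum u v) v)"
      by (rule of_bool_eq_add, rule diamond(2)) (use True in \<open>auto simp: slash_covers_def backslash_covers_def\<close>)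
    ultimately show ?thesis using True
      by (simp only: L2_def R2_relP relP_mult_nth F_zero_def F_minus_def F_plus_def
          vector_add_component relP_nth cdiag_nth) simp
  next
    case False
    thus ?thesis
      using card_backslash_covered[of u]
      by (auto simp: L2_def R2_relP relP_mult_nth F_zero_def F_plus_def relP_nth cdiag_nth
          not_covers_refl subspace_sum_refl)
  qed
  thus ?thesis by (simp add: vec_eq_iff)
qed

lemma L2_R2_matrix:
  "L2 ** R2 = F_plus + cdiag (\<lambda>u. q_bracket q (int h + int k - int (dim u))
      - q_bracket q (int k - int (dim (u \<inter> y))))" (is "_ = ?M")
proof -
  have "(L2 ** R2) $ u $ v = ?M $ u $ v" for u v
  proof (cases "u \<in> P \<and> v \<in> P \<and> u \<noteq> v")
    case True
    have "card {z \<in> P. backslash_covers z u \<and> backslash_covers z v} = of_bool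
        (backslash_covers (subspace_sum u v) u \<and> backslash_covers (subspace_sum u v) v)"
      using True by (intro card_common_upper) (auto simp: backslash_covers_def)
    thus ?thesis using True
      by (simp add: L2_def R2_relP relP_mult_nth F_plus_def relP_nth cdiag_nth)
  next
    case False
    thus ?thesis
      using card_backslash_covers[of u]
      by (auto simp: L2_def R2_relP relP_mult_nth F_plus_def relP_nth cdiag_nth
          not_covers_refl subspace_sum_refl)
  qed
  thus ?thesis by (simp add: vec_eq_iff)
qed

lemma L1_R2_matrix: "L1 ** R2 = R2 ** L1"
proof -
  have "(L1 ** R2) $ u $ v = (R2 ** L1) $ u $ v" for u v
  proof (cases "u \<in> P \<and> v \<in> P \<and> u \<noteq> v")
    case True
    have "card {z \<in> P. slash_covers z u \<and> backslash_covers z v} = of_bool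
        (slash_covers (subspace_sum u v) u \<and> backslash_covers (subspace_sum u v) v)"
      using True by (intro card_common_upper) (auto simp: slash_covers_def backslash_covers_def)
    moreover have "card {z \<in> P. backslash_covers u z \<and> slash_covers v z} = of_bool
        (backslash_covers u (u \<inter> v) \<and> slash_covers v (u \<inter> v))"
      using True by (intro card_common_lower) (auto simp: slash_covers_def backslash_covers_def)
    ultimately show ?thesis
      using True diamond(3)[of u v] unfolding L1_def R2_relP relP_mult_nth by simp
  next
    case False
    have "{z \<in> P. slash_covers z u \<and> backslash_covers z u} = {}"
      "{z \<in> P. backslash_covers u z \<and> slash_covers u z} = {}"
      by (auto simp: slash_covers_def backslash_covers_def)
    thus ?thesis using False
      by (cases "u = v") (simp only: L1_def R2_relP relP_mult_nth, auto simp: relP_mult_nth L1_def R2_relP)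
  qed
  thus ?thesis by (simp add: vec_eq_iff)
qed

lemma R1_L2_matrix: "R1 ** L2 = L2 ** R1"
proof -
  have "transpose (L1 ** R2) = transpose (R2 ** L1)" by (simp only: L1_R2_matrix)
  thus ?thesis by (simp add: matrix_transpose_mul R1_def R2_def)
qed

lemma L2_L1_matrix: "L2 ** L1 = real q *\<^sub>R (L1 ** L2)"
  using card_mixed_intermediate
  by (simp add: vec_eq_iff L1_def L2_def relP_mult_nth scaleR_conv_of_real[where 'a = complex])

lemma R1_R2_matrix: "R1 ** R2 = real q *\<^sub>R (R2 ** R1)"
proof -
  have "transpose (L2 ** L1) = transpose (real q *\<^sub>R (L1 ** L2))" by (simp only: L2_L1_matrix)
  thus ?thesis by (simp add: matrix_transpose_mul R1_def R2_def transpose_scalar)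
qed

lemma scaleR_matrix_vector: "(c *\<^sub>R A) *v w = of_real c *s (A *v w)"
  for A :: "complex ^ 'v set ^ 'v set"
  by (simp add: vec_eq_iff matrix_vector_mult_def sum_distrib_left mult.assoc
      scaleR_conv_of_real[where 'a = complex])

lemma L2_L1: "L2 *v (L1 *v w) = of_nat q *s (L1 *v (L2 *v w))"
  and R1_R2: "R1 *v (R2 *v w) = of_nat q *s (R2 *v (R1 *v w))"
  and L1_R2: "L1 *v (R2 *v w) = R2 *v (L1 *v w)"
  and R1_L2: "R1 *v (L2 *v w) = L2 *v (R1 *v w)"
  by (simp_all add: matrix_vector_mul_assoc L2_L1_matrix R1_R2_matrix L1_R2_matrix R1_L2_matrix
      scaleR_matrix_vector)

section \<open>Weight vectors\<close>

text \<open>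
  Vectors supported on \<open>Pij i j\<close>.  The indices are integers so that the generators shift them
  without boundary cases; outside the natural range the weight space is 0.
\<close>

definition wt :: "int \<Rightarrow> int \<Rightarrow> (complex ^ 'v set) set" where
  "wt i j = {w. \<forall>u. w $ u \<noteq> 0 \<longrightarrow> u \<in> P \<and> int (dim (u \<inter> y)) = i \<and> int (dim u) = i + j}"

lemma cdiag_mult_nth: "(cdiag d *v w) $ u = (if u \<in> P then d u * w $ u else 0)"
proof -
  have "cdiag d $ u $ v * w $ v = (if u = v then of_bool (u \<in> P) * d u * w $ u else 0)" for v
    by (simp add: cdiag_nth)
  thus ?thesis by (simp add: matrix_vector_mult_def)
qed

lemma cdiag_wt:
  assumes "w \<in> wt i j"
    and "\<And>u. \<lbrakk>int (dim (u \<inter> y)) = i; int (dim u) = i + j\<rbrakk> \<Longrightarrow> d u = c"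
  shows "cdiag d *v w = c *s w"
proof -
  have "(cdiag d *v w) $ u = (c *s w) $ u" for u
    using assms unfolding wt_def by (cases "w $ u = 0") (auto simp: cdiag_mult_nth)
  thus ?thesis by (simp add: vec_eq_iff)
qed

lemma relP_wt:
  assumes w: "w \<in> wt i j"
    and r: "\<And>u v. \<lbrakk>r u v; int (dim (v \<inter> y)) = i; int (dim v) = i + j\<rbrakk>
      \<Longrightarrow> int (dim (u \<inter> y)) = i' \<and> int (dim u) = i' + j'"
  shows "relP r *v w \<in> wt i' j'"
  unfolding wt_def
proof (clarify)
  fix u assume "(relP r *v w) $ u \<noteq> 0"
  then obtain v where "relP r $ u $ v * w $ v \<noteq> 0"
    unfolding matrix_vector_mult_def by (auto elim: sum.not_neutral_contains_not_neutral)
  hence "u \<in> P" "r u v" "w $ v \<noteq> 0" by (auto simp: relP_nth)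
  thus "u \<in> P \<and> int (dim (u \<inter> y)) = i' \<and> int (dim u) = i' + j'"
    using w r unfolding wt_def by auto
qed

lemma generators_wt:
  assumes "w \<in> wt i j"
  shows "L1 *v w \<in> wt (i - 1) j" "R1 *v w \<in> wt (i + 1) j"
    "L2 *v w \<in> wt i (j - 1)" "R2 *v w \<in> wt i (j + 1)"
    "F_zero *v w \<in> wt i j" "F_minus *v w \<in> wt i j" "F_plus *v w \<in> wt i j"
  unfolding L1_def R1_relP L2_def R2_relP F_zero_def F_plus_def F_minus_def
  by (rule relP_wt[OF assms];
      auto simp: slash_covers_def backslash_covers_def covers_def)+

lemma L1_R1:
  "w \<in> wt i j \<Longrightarrow> L1 *v (R1 *v w) =
    F_zero *v w + F_minus *v w + q_bracket q (int k - i) *s w"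
  by (simp add: matrix_vector_mul_assoc L1_R1_matrix matrix_vector_mult_add_rdistrib
      cdiag_wt[where c = "q_bracket q (int k - i)"])

lemma R1_L1:
  "w \<in> wt i j \<Longrightarrow> R1 *v (L1 *v w) =
    F_minus *v w + (q_bracket q (i + j) - q_bracket q j) *s w"
  by (simp add: matrix_vector_mul_assoc R1_L1_matrix matrix_vector_mult_add_rdistrib
      cdiag_wt[where c = "q_bracket q (i + j) - q_bracket q j"])

lemma R2_L2:
  "w \<in> wt i j \<Longrightarrow> R2 *v (L2 *v w) =
    F_zero *v w + F_plus *v w + q_bracket q j *s w"
  by (simp add: matrix_vector_mul_assoc R2_L2_matrix matrix_vector_mult_add_rdistrib
      cdiag_wt[where c = "q_bracket q j"])

lemma L2_R2:
  "w \<in> wt i j \<Longrightarrow> L2 *v (R2 *v w) = F_plus *v w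
    + (q_bracket q (int h + int k - (i + j)) - q_bracket q (int k - i)) *s w"
  by (simp add: matrix_vector_mul_assoc L2_R2_matrix matrix_vector_mult_add_rdistrib
      cdiag_wt[where c = "q_bracket q (int h + int k - (i + j)) - q_bracket q (int k - i)"])

section \<open>The matrices Omega on weight vectors\<close>

abbreviation Q :: complex where "Q \<equiv> of_nat q"

text \<open>
  The diagonal parts of \<open>L1 R1 - R1 L1\<close> and of \<open>R2 L2 - L2 R2\<close> at weight \<open>(i, j)\<close>: differences of
  numbers of covers and numbers of covered subspaces.
\<close>

definition slash_degree_diff :: "int \<Rightarrow> int \<Rightarrow> complex" where
  "slash_degree_diff i j = q_bracket q (int k - i) - q_bracket q (i + j) + q_bracket q j"

definition backslash_degree_diff :: "int \<Rightarrow> int \<Rightarrow> complex" where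
  "backslash_degree_diff i j = q_bracket q j - q_bracket q (int h + int k - i - j) + q_bracket q (int k - i)"

lemma F_zero_eq1:
  "w \<in> wt i j \<Longrightarrow> F_zero *v w = L1 *v (R1 *v w) - R1 *v (L1 *v w) - slash_degree_diff i j *s w"
  by (simp add: L1_R1 R1_L1 slash_degree_diff_def vec_eq_iff algebra_simps)

lemma F_zero_eq2:
  "w \<in> wt i j \<Longrightarrow> F_zero *v w = R2 *v (L2 *v w) - L2 *v (R2 *v w) - backslash_degree_diff i j *s w"
  by (simp add: L2_R2 R2_L2 backslash_degree_diff_def vec_eq_iff algebra_simps)

text \<open>
  To move \<open>F_zero\<close> past \<open>L1\<close> or \<open>R1\<close>, write it with \<open>L2\<close> and \<open>R2\<close>, with which \<open>L1\<close> and \<open>R1\<close>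
  commute up to a power of \<open>q\<close>; for \<open>L2\<close> and \<open>R2\<close> write it with \<open>L1\<close> and \<open>R1\<close>.  The factor \<open>q\<close>
  is put on the side where no inverse is needed.
\<close>

lemma F_zero_L1:
  assumes "w \<in> wt i j"
  shows "F_zero *v (L1 *v w) = Q *s (L1 *v (F_zero *v w)) + (Q * backslash_degree_diff i j - backslash_degree_diff (i - 1) j) *s (L1 *v w)"
  by (simp add: F_zero_eq2[OF assms] F_zero_eq2[OF generators_wt(1)[OF assms]] mat_vec_simps
      L2_L1 L1_R2 vec_eq_iff algebra_simps flip: L1_R2)

lemma F_zero_R1:
  assumes "w \<in> wt i j"
  shows "Q *s (F_zero *v (R1 *v w)) = R1 *v (F_zero *v w) + (backslash_degree_diff i j - Q * backslash_degree_diff (i + 1) j) *s (R1 *v w)"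
proof -
  have "R1 *v (L2 *v (R2 *v w)) = Q *s (L2 *v (R2 *v (R1 *v w)))"
    by (simp add: R1_L2 R1_R2 mat_vec_simps)
  thus ?thesis
    by (simp add: F_zero_eq2[OF assms] F_zero_eq2[OF generators_wt(2)[OF assms]] mat_vec_simps
      R1_R2 R1_L2 vec_eq_iff algebra_simps)
qed

lemma F_zero_L2:
  assumes "w \<in> wt i j"
  shows "Q *s (F_zero *v (L2 *v w)) = L2 *v (F_zero *v w) + (slash_degree_diff i j - Q * slash_degree_diff i (j - 1)) *s (L2 *v w)"
  by (simp add: F_zero_eq1[OF assms] F_zero_eq1[OF generators_wt(3)[OF assms]] mat_vec_simps
      L2_L1 R1_L2 vec_eq_iff algebra_simps flip: R1_L2)

lemma F_zero_R2:
  assumes "w \<in> wt i j"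
  shows "F_zero *v (R2 *v w) = Q *s (R2 *v (F_zero *v w)) + (Q * slash_degree_diff i j - slash_degree_diff i (j + 1)) *s (R2 *v w)"
  by (simp add: F_zero_eq1[OF assms] F_zero_eq1[OF generators_wt(4)[OF assms]] mat_vec_simps
      R1_R2 L1_R2 vec_eq_iff algebra_simps)

lemma diagP_wt:
  assumes "w \<in> wt i j"
    and "\<And>u. \<lbrakk>int (dim (u \<inter> y)) = i; int (dim u) = i + j\<rbrakk> \<Longrightarrow> d u = c"
  shows "diagP d *v w = of_real c *s w"
  unfolding diagP_eq_cdiag using assms by (intro cdiag_wt) auto

lemma K_wt:
  assumes "w \<in> wt i j"
  shows "K1 *v w = of_real (real q powr (real k / 2 - of_int i)) *s w"
    "K1_inv *v w = of_real (real q powr (of_int i - real k / 2)) *s w"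
    "K2 *v w = of_real (real q powr (of_int j - real h / 2)) *s w"
    "K2_inv *v w = of_real (real q powr (real h / 2 - of_int j)) *s w"
    "IP *v w = w"
proof -
  have *: "real (dim (u \<inter> y)) = of_int i \<and> real (dim u) = of_int i + of_int j"
    if "int (dim (u \<inter> y)) = i" "int (dim u) = i + j" for u
    using that by (metis of_int_add of_int_of_nat_eq)
  show "K1 *v w = of_real (real q powr (real k / 2 - of_int i)) *s w"
    unfolding K1_def by (rule diagP_wt[OF assms]) (simp add: K1_entry_def *)
  show "K1_inv *v w = of_real (real q powr (of_int i - real k / 2)) *s w"
    unfolding K1_inv_def
    by (rule diagP_wt[OF assms]) (simp add: K1_entry_def * flip: powr_minus)
  show "K2 *v w = of_real (real q powr (of_int j - real h / 2)) *s w"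
    unfolding K2_def by (rule diagP_wt[OF assms]) (simp add: K2_entry_def *)
  show "K2_inv *v w = of_real (real q powr (real h / 2 - of_int j)) *s w"
    unfolding K2_inv_def
    by (rule diagP_wt[OF assms]) (simp add: K2_entry_def * flip: powr_minus)
  have "IP *v w = of_real 1 *s w"
    unfolding IP_def by (rule diagP_wt[OF assms]) simp
  thus "IP *v w = w" by simp
qed

lemma of_real_powr_int:
  "x = of_int n \<Longrightarrow> of_real (real q powr x) = Q powi n"
  using q_ge_2 by (simp add: powr_real_of_int' of_real_power_int)

text \<open>
  On weight vectors the half-integer powers of \<open>q\<close> in the definitions combine to integer powers.
\<close>

lemma Omega0_wt:
  assumes w: "w \<in> wt i j"
  shows "Omega0 *v w = ((Q - 1) * Q powi (i - j - int k)) *s (F_zero *v w)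
    + (Q powi (i - int k) + Q powi (- j) - Q powi (i - j - int k)) *s w"
proof -
  define c a b hh kk where abc: "c = complex_of_real (real q powr (- (real h + real k) / 2))"
    "a = complex_of_real (real q powr (of_int i - real k / 2))"
    "b = complex_of_real (real q powr (real h / 2 - of_int j))"
    "hh = complex_of_real (real q powr (real h / 2))"
    "kk = complex_of_real (real q powr (real k / 2))"
  have s: "c * a * b = Q powi (i - j - int k)" "c * hh * a = Q powi (i - int k)"
    "c * kk * b = Q powi (- j)"
    unfolding abc of_real_mult[symmetric] powr_add[symmetric]
    by (rule of_real_powr_int, simp add: field_simps)+
  have "Omega0 *v w = c *s (((Q - 1) * (a * b)) *s (F_zero *v w) + (hh * a) *s w + (kk * b) *s w
      - (a * b) *s w)"
    unfolding Omega0_def abc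
    by (simp add: scaleR_matrix_vector matrix_vector_mult_add_rdistrib
        matrix_vector_mult_diff_rdistrib K_wt[OF w] mat_vec_simps mult_ac
        flip: matrix_vector_mul_assoc)
  also have "\<dots> = ((Q - 1) * (c * a * b)) *s (F_zero *v w) + (c * hh * a + c * kk * b - c * a * b) *s w"
    by (simp add: vec_eq_iff algebra_simps)
  finally show ?thesis unfolding s .
qed

lemma Omega1_wt:
  assumes w: "w \<in> wt i j"
  shows "Omega1 *v w = Q powi (1 - j) *s (F_zero *v w) + ((Q - 1) * Q powi (- j)) *s (F_minus *v w)
    + ((Q powi (1 + int k - i - j) + Q powi (1 + i) - Q powi (1 - j) - Q) / (Q - 1)) *s w"
proof -
  define c a b d kk hk where abc: "c = complex_of_real (real q powr (- real h / 2))"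
    "a = complex_of_real (real q powr (of_int i - real k / 2))"
    "b = complex_of_real (real q powr (real h / 2 - of_int j))"
    "d = complex_of_real (real q powr (real k / 2 - of_int i))"
    "kk = complex_of_real (real q powr (real k / 2 + 1))"
    "hk = complex_of_real (real q powr ((real h + real k) / 2 + 1))"
  have s: "c * b = Q powi (- j)" "c * kk * d * b = Q powi (1 + int k - i - j)"
    "c * hk * a = Q powi (1 + i)"
    unfolding abc of_real_mult[symmetric] powr_add[symmetric]
    by (rule of_real_powr_int, simp add: field_simps)+
  have s': "Q powi (1 - j) = Q * (c * b)"
    unfolding s using of_nat_q_nontrivial by (simp add: power_int_diff power_int_minus field_simps)
  have "Omega1 *v w = c *s ((Q * b) *s (F_zero *v w) + ((Q - 1) * b) *s (F_minus *v w)
      + inverse (Q - 1) *s ((kk * d * b) *s w + (hk * a) *s w - (Q * b) *s w)) - (Q / (Q - 1)) *s w"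
    unfolding Omega1_def abc
    by (simp add: scaleR_matrix_vector matrix_vector_mult_add_rdistrib
        matrix_vector_mult_diff_rdistrib K_wt[OF w] mat_vec_simps mult_ac
        flip: matrix_vector_mul_assoc)
  also have "\<dots> = (Q * (c * b)) *s (F_zero *v w) + ((Q - 1) * (c * b)) *s (F_minus *v w)
      + ((c * kk * d * b + c * hk * a - Q * (c * b) - Q) / (Q - 1)) *s w"
    using of_nat_q_nontrivial by (simp add: vec_eq_iff divide_inverse algebra_simps)
  finally show ?thesis unfolding s' s .
qed

lemma Omega2_wt:
  assumes w: "w \<in> wt i j"
  shows "Omega2 *v w = Q powi (1 + i - int k) *s (F_zero *v w)
    + ((Q - 1) * Q powi (i - int k)) *s (F_plus *v w)
    + ((Q powi (1 + i + j - int k) + Q powi (1 + int h - j) - Q powi (1 + i - int k) - Q) / (Q - 1)) *s w"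
proof -
  define c a b d hh hk where abc: "c = complex_of_real (real q powr (- real k / 2))"
    "a = complex_of_real (real q powr (of_int i - real k / 2))"
    "b = complex_of_real (real q powr (real h / 2 - of_int j))"
    "d = complex_of_real (real q powr (of_int j - real h / 2))"
    "hh = complex_of_real (real q powr (real h / 2 + 1))"
    "hk = complex_of_real (real q powr ((real h + real k) / 2 + 1))"
  have s: "c * a = Q powi (i - int k)" "c * hh * a * d = Q powi (1 + i + j - int k)"
    "c * hk * b = Q powi (1 + int h - j)"
    unfolding abc of_real_mult[symmetric] powr_add[symmetric]
    by (rule of_real_powr_int, simp add: field_simps)+
  have s': "Q powi (1 + i - int k) = Q * (c * a)"
    unfolding s using of_nat_q_nontrivial by (simp add: power_int_diff power_int_add field_simps)
  have "Omega2 *v w = c *s ((Q * a) *s (F_zero *v w) + ((Q - 1) * a) *s (F_plus *v w)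
      + inverse (Q - 1) *s ((hh * a * d) *s w + (hk * b) *s w - (Q * a) *s w)) - (Q / (Q - 1)) *s w"
    unfolding Omega2_def abc
    by (simp add: scaleR_matrix_vector matrix_vector_mult_add_rdistrib
        matrix_vector_mult_diff_rdistrib K_wt[OF w] mat_vec_simps mult_ac
        flip: matrix_vector_mul_assoc)
  also have "\<dots> = (Q * (c * a)) *s (F_zero *v w) + ((Q - 1) * (c * a)) *s (F_plus *v w)
      + ((c * hh * a * d + c * hk * b - Q * (c * a) - Q) / (Q - 1)) *s w"
    using of_nat_q_nontrivial by (simp add: vec_eq_iff divide_inverse algebra_simps)
  finally show ?thesis unfolding s' s .
qed

lemmas powi_simps = power_int_diff power_int_add power_int_minus q_bracket_def

text \<open>
  The factor \<open>q\<close> by which \<open>F_zero\<close> fails to commute with a generator cancels the change of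
  \<open>q^(i - j - k)\<close>, and the remaining diagonal terms match.
\<close>

lemma Omega0_L1:
  assumes w: "w \<in> wt i j"
  shows "Omega0 *v (L1 *v w) = L1 *v (Omega0 *v w)"
proof -
  let ?s = "\<lambda>i. (Q - 1) * Q powi (i - j - int k)"
  let ?c = "\<lambda>i. Q powi (i - int k) + Q powi (- j) - Q powi (i - j - int k)"
  have s: "?s i = ?s (i - 1) * Q" "?c i = ?s (i - 1) * (Q * backslash_degree_diff i j - backslash_degree_diff (i - 1) j) + ?c (i - 1)"
    using of_nat_q_nontrivial by (simp_all add: powi_simps backslash_degree_diff_def divide_simps) (simp_all add: algebra_simps)?
  have "Omega0 *v (L1 *v w) = ?s (i - 1) *s (F_zero *v (L1 *v w)) + ?c (i - 1) *s (L1 *v w)"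
    by (rule Omega0_wt[OF generators_wt(1)[OF w]])
  also have "\<dots> = ?s i *s (L1 *v (F_zero *v w)) + ?c i *s (L1 *v w)"
    unfolding F_zero_L1[OF w] s
    by (simp only: vector_add_ldistrib vector_smult_assoc add.assoc vector_sadd_rdistrib)
  also have "\<dots> = L1 *v (Omega0 *v w)"
    by (simp only: Omega0_wt[OF w] mat_vec_simps)
  finally show ?thesis .
qed

lemma Omega0_R2:
  assumes w: "w \<in> wt i j"
  shows "Omega0 *v (R2 *v w) = R2 *v (Omega0 *v w)"
proof -
  let ?s = "\<lambda>j. (Q - 1) * Q powi (i - j - int k)"
  let ?c = "\<lambda>j. Q powi (i - int k) + Q powi (- j) - Q powi (i - j - int k)"
  have s: "?s j = ?s (j + 1) * Q" "?c j = ?s (j + 1) * (Q * slash_degree_diff i j - slash_degree_diff i (j + 1)) + ?c (j + 1)"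
    using of_nat_q_nontrivial by (simp_all add: powi_simps slash_degree_diff_def divide_simps) (simp_all add: algebra_simps)?
  have "Omega0 *v (R2 *v w) = ?s (j + 1) *s (F_zero *v (R2 *v w)) + ?c (j + 1) *s (R2 *v w)"
    by (rule Omega0_wt[OF generators_wt(4)[OF w]])
  also have "\<dots> = ?s j *s (R2 *v (F_zero *v w)) + ?c j *s (R2 *v w)"
    unfolding F_zero_R2[OF w] s
    by (simp only: vector_add_ldistrib vector_smult_assoc add.assoc vector_sadd_rdistrib)
  also have "\<dots> = R2 *v (Omega0 *v w)"
    by (simp only: Omega0_wt[OF w] mat_vec_simps)
  finally show ?thesis .
qed

lemma Omega0_R1:
  assumes w: "w \<in> wt i j"
  shows "Omega0 *v (R1 *v w) = R1 *v (Omega0 *v w)"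
proof -
  let ?s = "\<lambda>i. (Q - 1) * Q powi (i - j - int k)"
  let ?c = "\<lambda>i. Q powi (i - int k) + Q powi (- j) - Q powi (i - j - int k)"
  have s: "?s (i + 1) = ?s i * Q" "?s i * (backslash_degree_diff i j - Q * backslash_degree_diff (i + 1) j) + ?c (i + 1) = ?c i"
    using of_nat_q_nontrivial by (simp_all add: powi_simps backslash_degree_diff_def divide_simps) (simp_all add: algebra_simps)?
  have "Omega0 *v (R1 *v w) = ?s i *s (Q *s (F_zero *v (R1 *v w))) + ?c (i + 1) *s (R1 *v w)"
    by (simp only: Omega0_wt[OF generators_wt(2)[OF w]] s vector_smult_assoc)
  also have "\<dots> = ?s i *s (R1 *v (F_zero *v w)) + ?c i *s (R1 *v w)"
    unfolding F_zero_R1[OF w] s(2)[symmetric]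
    by (simp only: vector_add_ldistrib vector_smult_assoc add.assoc vector_sadd_rdistrib)
  also have "\<dots> = R1 *v (Omega0 *v w)"
    by (simp only: Omega0_wt[OF w] mat_vec_simps)
  finally show ?thesis .
qed

lemma Omega0_L2:
  assumes w: "w \<in> wt i j"
  shows "Omega0 *v (L2 *v w) = L2 *v (Omega0 *v w)"
proof -
  let ?s = "\<lambda>j. (Q - 1) * Q powi (i - j - int k)"
  let ?c = "\<lambda>j. Q powi (i - int k) + Q powi (- j) - Q powi (i - j - int k)"
  have s: "?s (j - 1) = ?s j * Q" "?s j * (slash_degree_diff i j - Q * slash_degree_diff i (j - 1)) + ?c (j - 1) = ?c j"
    using of_nat_q_nontrivial by (simp_all add: powi_simps slash_degree_diff_def divide_simps) (simp_all add: algebra_simps)?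
  have "Omega0 *v (L2 *v w) = ?s j *s (Q *s (F_zero *v (L2 *v w))) + ?c (j - 1) *s (L2 *v w)"
    by (simp only: Omega0_wt[OF generators_wt(3)[OF w]] s vector_smult_assoc)
  also have "\<dots> = ?s j *s (L2 *v (F_zero *v w)) + ?c j *s (L2 *v w)"
    unfolding F_zero_L2[OF w] s(2)[symmetric]
    by (simp only: vector_add_ldistrib vector_smult_assoc add.assoc vector_sadd_rdistrib)
  also have "\<dots> = L2 *v (Omega0 *v w)"
    by (simp only: Omega0_wt[OF w] mat_vec_simps)
  finally show ?thesis .
qed

section \<open>Weight projections and Schur's lemma\<close>

lemma cdiag_mult: "cdiag d ** cdiag e = cdiag (\<lambda>u. d u * e u)"
proof -
  have "cdiag d *v (cdiag e *v w) = cdiag (\<lambda>u. d u * e u) *v w" for w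
    by (simp add: vec_eq_iff cdiag_mult_nth)
  thus ?thesis by (simp add: matrix_eq matrix_vector_mul_assoc)
qed

lemma cdiag_const_H_alg: "cdiag (\<lambda>u. c) \<in> H_alg"
proof -
  have "(\<chi> u v. c * IP $ u $ v) = cdiag (\<lambda>u. c)"
    by (simp add: vec_eq_iff IP_def diagP_eq_cdiag cdiag_nth)
  thus ?thesis using H_alg.scal[OF H_alg.one, of c] by simp
qed

text \<open>
  The Lagrange interpolation polynomial that is 1 at \<open>c\<close> and 0 at the other values of \<open>d\<close>, evaluated
  at the matrix \<open>cdiag d\<close>.
\<close>

lemma cdiag_level_H_alg:
  assumes "cdiag d \<in> H_alg"
  shows "cdiag (\<lambda>u. of_bool (d u = c)) \<in> H_alg"
proof -
  have prod: "cdiag (\<lambda>u. \<Prod>s\<in>S. (d u - s) / (c - s)) \<in> H_alg" if "finite S" for S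
    using that
  proof (induction S)
    case empty
    show ?case using cdiag_const_H_alg[of 1] by simp
  next
    case (insert s S)
    have "cdiag (\<lambda>u. (d u - s) / (c - s)) =
        cdiag (\<lambda>u. 1 / (c - s)) ** (cdiag d + cdiag (\<lambda>u. - s))"
    proof -
      have "cdiag d + cdiag (\<lambda>u. - s) = cdiag (\<lambda>u. d u - s)"
        by (simp add: vec_eq_iff cdiag_nth)
      thus ?thesis by (simp add: cdiag_mult)
    qed
    hence "cdiag (\<lambda>u. (d u - s) / (c - s)) \<in> H_alg"
      using assms cdiag_const_H_alg by (simp add: H_alg.mult H_alg.add)
    from H_alg.mult[OF this insert.IH] show ?case using insert.hyps by (simp add: cdiag_mult)
  qed
  have "(\<Prod>s\<in>range d - {c}. (d u - s) / (c - s)) = of_bool (d u = c)" for u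
  proof (cases "d u = c")
    case False
    hence "\<exists>s\<in>range d - {c}. (d u - s) / (c - s) = 0" by (intro bexI[of _ "d u"]) auto
    thus ?thesis using False by (simp add: prod_zero_iff)
  qed (auto intro: prod.neutral)
  thus ?thesis using prod[of "range d - {c}"] by simp
qed

text \<open>
  The entries of \<open>K1\<close> and \<open>K2\<close> determine \<open>i\<close> and \<open>j\<close>, so \<open>Estar i j\<close> is a product of two spectral
  projections.
\<close>

lemma Estar_H_alg: "Estar i j \<in> H_alg"
proof -
  let ?a = "real q powr (real k / 2 - real i)" and ?b = "real q powr (real j - real h / 2)"
  have "cdiag (\<lambda>u. of_bool (complex_of_real (K1_entry u) = of_real ?a)) \<in> H_alg"
    "cdiag (\<lambda>u. of_bool (complex_of_real (K2_entry u) = of_real ?b)) \<in> H_alg"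
    by (rule cdiag_level_H_alg, rule H_alg.gen,
        simp add: K1_def K2_def flip: diagP_eq_cdiag)+
  note H_alg.mult[OF this]
  moreover have "cdiag (\<lambda>u. of_bool (complex_of_real (K1_entry u) = of_real ?a)) **
      cdiag (\<lambda>u. of_bool (complex_of_real (K2_entry u) = of_real ?b)) = Estar i j"
  proof -
    have inj: "real q powr x = real q powr z \<longleftrightarrow> x = z" for x z
      using q_ge_2 powr_inj[of "real q"] by simp
    have "(K1_entry u = ?a \<and> K2_entry u = ?b) = (dim (u \<inter> y) = i \<and> dim u = i + j)" for u
      unfolding K1_entry_def K2_entry_def inj by auto
    thus ?thesis unfolding cdiag_mult
      by (auto simp: vec_eq_iff cdiag_nth Estar_def diagP_def Pij_def)
  qed
  ultimately show ?thesis by simp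
qed

lemma Estar_nth: "(Estar i j *v w) $ u = of_bool (u \<in> Pij i j) * w $ u"
  unfolding Estar_def diagP_eq_cdiag cdiag_mult_nth by (auto simp: Pij_def)

lemma Estar_wt: "Estar i j *v w \<in> wt (int i) (int j)"
  by (auto simp: wt_def Estar_nth Pij_def)

lemma Estar_fixes_wt: "w \<in> wt (int i) (int j) \<Longrightarrow> Estar i j *v w = w"
  by (auto simp: vec_eq_iff Estar_nth wt_def Pij_def)

lemma sum_Estar:
  assumes "w \<in> VP"
  shows "(\<Sum>i\<le>h + k. \<Sum>j\<le>h + k. Estar i j *v w) = w"
proof -
  have "(\<Sum>i\<le>h + k. \<Sum>j\<le>h + k. Estar i j *v w) $ u = w $ u" for u
  proof (cases "u \<in> P")
    case False
    thus ?thesis using assms by (simp add: VP_def Estar_nth Pij_def sum_component)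
  next
    case True
    define a b where "a = dim (u \<inter> y)" and "b = dim u - dim (u \<inter> y)"
    have "dim (u \<inter> y) \<le> dim u" "dim u \<le> h + k"
      using fd.dim_subset[of "u \<inter> y" u] fd.dim_subset[of u UNIV] dim_space by auto
    hence ab: "a \<le> h + k" "b \<le> h + k" and "u \<in> Pij i j \<longleftrightarrow> i = a \<and> j = b" for i j
      using True unfolding a_def b_def Pij_def by auto
    hence "(\<Sum>i\<le>h + k. \<Sum>j\<le>h + k. Estar i j *v w) $ u =
        (\<Sum>i\<le>h + k. \<Sum>j\<le>h + k. if i = a then if j = b then w $ u else 0 else 0)"
      unfolding sum_component Estar_nth by (intro sum.cong) auto
    also have "\<dots> = (\<Sum>i\<le>h + k. if i = a then (\<Sum>j\<le>h + k. if j = b then w $ u else 0) else 0)"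
      by (intro sum.cong) auto
    also have "\<dots> = w $ u" using ab by simp
    finally show ?thesis .
  qed
  thus ?thesis by (simp add: vec_eq_iff)
qed

lemma submodule_closed:
  assumes "H_submodule W" "w \<in> W"
  shows "L1 *v w \<in> W" "L2 *v w \<in> W" "R1 *v w \<in> W" "R2 *v w \<in> W" "Estar i j *v w \<in> W"
  using assms Estar_H_alg unfolding H_submodule_def by (auto intro: H_alg.gen)

lemma submodule_linear:
  assumes "H_submodule W"
  shows "w \<in> W \<Longrightarrow> c *s w \<in> W" "\<lbrakk>w \<in> W; w' \<in> W\<rbrakk> \<Longrightarrow> w + w' \<in> W"
    "\<lbrakk>w \<in> W; w' \<in> W\<rbrakk> \<Longrightarrow> w - w' \<in> W"
  using assms unfolding H_submodule_def
  by (auto intro: vec.subspace_scale vec.subspace_add vec.subspace_diff)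

text \<open>
  Since a submodule contains the weight components of its vectors, additive properties need only be
  checked on its weight vectors.
\<close>

lemma weight_decomposition_induct:
  assumes W: "H_submodule W" and w: "w \<in> W"
    and zero: "S 0" and add: "\<And>x z. S x \<Longrightarrow> S z \<Longrightarrow> S (x + z)"
    and weight: "\<And>i j x. \<lbrakk>x \<in> W; x \<in> wt i j\<rbrakk> \<Longrightarrow> S x"
  shows "S w"
proof -
  have sums: "S (\<Sum>i\<le>n. f i)" if "\<And>i. S (f i)" for n :: nat and f
    using that by (induction n) (auto intro: add)
  have "S (\<Sum>i\<le>h + k. \<Sum>j\<le>h + k. Estar i j *v w)"
    by (intro sums weight[OF submodule_closed(5)[OF W w] Estar_wt])
  thus ?thesis using sum_Estar[of w] W w by (auto simp: H_submodule_def)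
qed

lemma K_wt_scalar:
  assumes "A \<in> {K1, K1_inv, K2, K2_inv}"
  obtains c where "\<And>w. w \<in> wt i j \<Longrightarrow> A *v w = c *s w"
  using assms K_wt(1-4) by blast

text \<open>
  The eigenspace of \<open>T\<close> for the eigenvalue \<open>c\<close> inside \<open>W\<close> is a nonzero submodule, hence all of
  \<open>W\<close>.  It is enough that \<open>T\<close> commutes with the lowering and raising matrices on weight vectors of
  \<open>W\<close>, because a matrix that preserves weight spaces commutes with the diagonal generators.
\<close>

lemma schur:
  assumes irr: "irreducible_H_module W"
    and pres: "\<And>i j w. \<lbrakk>w \<in> W; w \<in> wt i j\<rbrakk> \<Longrightarrow> T *v w \<in> wt i j"
    and comm: "\<And>i j w A. \<lbrakk>w \<in> W; w \<in> wt i j; A \<in> {L1, L2, R1, R2}\<rbrakk> \<Longrightarrow> T *v (A *v w) = A *v (T *v w)"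
    and w0: "w0 \<in> W" "w0 \<noteq> 0" "T *v w0 = c *s w0"
    and w: "w \<in> W"
  shows "T *v w = c *s w"
proof -
  have sub: "H_submodule W" using irr by (simp add: irreducible_H_module_def)
  have gens: "T *v (A *v x) = A *v (T *v x)"
    if A: "A \<in> {L1, L2, R1, R2, K1, K1_inv, K2, K2_inv}" and x: "x \<in> W" for A x
  proof (rule weight_decomposition_induct[OF sub x])
    fix i j x assume x: "x \<in> W" "x \<in> wt i j"
    show "T *v (A *v x) = A *v (T *v x)"
    proof (cases "A \<in> {L1, L2, R1, R2}")
      case False
      hence "A \<in> {K1, K1_inv, K2, K2_inv}" using A by blast
      then obtain a where "\<And>w. w \<in> wt i j \<Longrightarrow> A *v w = a *s w"
        using K_wt_scalar[of A i j] by blast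
      thus ?thesis using x pres by (simp add: vector_scalar_commute)
    qed (use comm x in blast)
  qed (simp_all add: mat_vec_simps)
  have alg: "A *v x \<in> W \<and> T *v (A *v x) = A *v (T *v x)" if "A \<in> H_alg" "x \<in> W" for A x
    using that
  proof (induction arbitrary: x)
    case (gen A)
    thus ?case using gens sub by (auto simp: H_submodule_def intro: H_alg.gen)
  next
    case one
    have "x \<in> VP" if "x \<in> W" for x using sub that by (auto simp: H_submodule_def)
    hence IPx: "IP *v x = x" if "x \<in> W" for x
      using that by (auto simp: vec_eq_iff IP_def diagP_eq_cdiag cdiag_mult_nth VP_def)
    have "IP *v (T *v x) = T *v x"
      by (rule weight_decomposition_induct[OF sub one]) (auto simp: mat_vec_simps intro: K_wt(5)[OF pres])
    thus ?case using IPx one by simp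
  next
    case (add A B)
    thus ?case using submodule_linear[OF sub] by (simp add: matrix_vector_mult_add_rdistrib mat_vec_simps)
  next
    case (scal A c)
    have "(\<chi> u v. c * A $ u $ v) *v x = c *s (A *v x)" for x
      by (simp add: vec_eq_iff matrix_vector_mult_def sum_distrib_left mult.assoc)
    thus ?case using scal submodule_linear[OF sub] by (simp add: mat_vec_simps)
  next
    case (mult A B)
    thus ?case by (simp flip: matrix_vector_mul_assoc)
  qed
  define W' where "W' = {x \<in> W. T *v x = c *s x}"
  have "vec.subspace W'"
    using sub unfolding W'_def H_submodule_def vec.subspace_def
    by (auto simp: mat_vec_simps vector_add_ldistrib mult.commute)
  hence "H_submodule W'"
    using sub alg unfolding H_submodule_def W'_def by (auto simp: vector_scalar_commute)
  moreover have "W' \<subseteq> W" "W' \<noteq> {0}" using w0 unfolding W'_def by auto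
  ultimately have "W' = W" using irr by (auto simp: irreducible_H_module_def)
  thus ?thesis using w unfolding W'_def by blast
qed

section \<open>Omega1 and Omega2 where Omega0 is a scalar\<close>

text \<open>
  An eigenvalue equation for \<open>Omega0\<close> on a weight vector can be solved for \<open>F_zero\<close>, since the
  coefficient of \<open>F_zero\<close> in \<open>Omega0_wt\<close> is nonzero.
\<close>

lemma F_zero_scalar:
  assumes w: "w \<in> wt i j" and lam: "Omega0 *v w = c *s w"
  shows "F_zero *v w = ((c * Q powi (int k + j - i) - Q powi j - Q powi (int k - i) + 1) / (Q - 1)) *s w"
proof -
  let ?s = "(Q - 1) * Q powi (i - j - int k)"
    and ?e = "Q powi (i - int k) + Q powi (- j) - Q powi (i - j - int k)"
  have "?s \<noteq> 0" using of_nat_q_nontrivial by simp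
  have "?s *s (F_zero *v w) = (c - ?e) *s w"
    using lam unfolding Omega0_wt[OF w] by (simp add: eq_diff_eq vec.scale_left_diff_distrib)
  hence "inverse ?s *s (?s *s (F_zero *v w)) = inverse ?s *s ((c - ?e) *s w)" by simp
  hence "F_zero *v w = (inverse ?s * (c - ?e)) *s w"
    by (simp only: vector_smult_assoc left_inverse[OF \<open>?s \<noteq> 0\<close>] vec.scale_one)
  also have "inverse ?s * (c - ?e) =
      (c * Q powi (int k + j - i) - Q powi j - Q powi (int k - i) + 1) / (Q - 1)"
    using of_nat_q_nontrivial by (simp add: powi_simps divide_simps) (simp add: algebra_simps power2_eq_square)?
  finally show ?thesis .
qed

lemma L1_R1_commutator_scalar:
  assumes w: "w \<in> wt i j" and lam: "Omega0 *v w = c *s w"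
  shows "L1 *v (R1 *v w) = R1 *v (L1 *v w)
    + ((c * Q powi (int k + j - i) - Q powi (i + j)) / (Q - 1)) *s w"
proof -
  have "L1 *v (R1 *v w) = R1 *v (L1 *v w) + (F_zero *v w + slash_degree_diff i j *s w)"
    unfolding F_zero_eq1[OF w] by simp
  also have "F_zero *v w + slash_degree_diff i j *s w
      = ((c * Q powi (int k + j - i) - Q powi (i + j)) / (Q - 1)) *s w"
    unfolding F_zero_scalar[OF w lam] vector_sadd_rdistrib[symmetric] slash_degree_diff_def q_bracket_def
    by (rule arg_cong[where f = "\<lambda>c. c *s w"])
      (simp flip: diff_divide_distrib add_divide_distrib)
  finally show ?thesis .
qed

lemma R2_L2_commutator_scalar:
  assumes w: "w \<in> wt i j" and lam: "Omega0 *v w = c *s w"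
  shows "R2 *v (L2 *v w) = L2 *v (R2 *v w)
    + ((c * Q powi (int k + j - i) - Q powi (int h + int k - i - j)) / (Q - 1)) *s w"
proof -
  have "R2 *v (L2 *v w) = L2 *v (R2 *v w) + (F_zero *v w + backslash_degree_diff i j *s w)"
    unfolding F_zero_eq2[OF w] by simp
  also have "F_zero *v w + backslash_degree_diff i j *s w
      = ((c * Q powi (int k + j - i) - Q powi (int h + int k - i - j)) / (Q - 1)) *s w"
    unfolding F_zero_scalar[OF w lam] vector_sadd_rdistrib[symmetric] backslash_degree_diff_def q_bracket_def
    by (rule arg_cong[where f = "\<lambda>c. c *s w"])
      (simp flip: diff_divide_distrib add_divide_distrib)
  finally show ?thesis .
qed

text \<open>
  Here \<open>F_minus\<close> is replaced by \<open>R1 L1\<close> and a diagonal term, and \<open>F_zero\<close> by its scalar.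
\<close>

lemma Omega1_scalar:
  assumes w: "w \<in> wt i j" and lam: "Omega0 *v w = c *s w"
  shows "Omega1 *v w = ((Q - 1) * Q powi (- j)) *s (R1 *v (L1 *v w))
    + ((c * Q powi (int k - i + 1) + Q powi i - Q - 1) / (Q - 1)) *s w"
proof -
  let ?f = "(c * Q powi (int k + j - i) - Q powi j - Q powi (int k - i) + 1) / (Q - 1)"
  let ?g = "q_bracket q (i + j) - q_bracket q j"
  have F: "F_minus *v w = R1 *v (L1 *v w) - ?g *s w" by (simp add: R1_L1[OF w])
  have "Omega1 *v w = ((Q - 1) * Q powi (- j)) *s (R1 *v (L1 *v w))
    + (Q powi (1 - j) * ?f - (Q - 1) * Q powi (- j) * ?g
      + (Q powi (1 + int k - i - j) + Q powi (1 + i) - Q powi (1 - j) - Q) / (Q - 1)) *s w"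
    unfolding Omega1_wt[OF w] F F_zero_scalar[OF w lam]
    by (simp add: vec_eq_iff ring_distribs)
  also have "Q powi (1 - j) * ?f - (Q - 1) * Q powi (- j) * ?g
      + (Q powi (1 + int k - i - j) + Q powi (1 + i) - Q powi (1 - j) - Q) / (Q - 1)
      = (c * Q powi (int k - i + 1) + Q powi i - Q - 1) / (Q - 1)"
    using of_nat_q_nontrivial by (simp add: powi_simps divide_simps) (simp add: algebra_simps power2_eq_square)?
  finally show ?thesis .
qed

lemma Omega2_scalar:
  assumes w: "w \<in> wt i j" and lam: "Omega0 *v w = c *s w"
  shows "Omega2 *v w = ((Q - 1) * Q powi (i - int k)) *s (L2 *v (R2 *v w))
    + ((c * Q powi (j + 1) + Q powi (int h - j) - Q - 1) / (Q - 1)) *s w"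
proof -
  let ?f = "(c * Q powi (int k + j - i) - Q powi j - Q powi (int k - i) + 1) / (Q - 1)"
  let ?g = "q_bracket q (int h + int k - (i + j)) - q_bracket q (int k - i)"
  have F: "F_plus *v w = L2 *v (R2 *v w) - ?g *s w" by (simp add: L2_R2[OF w])
  have "Omega2 *v w = ((Q - 1) * Q powi (i - int k)) *s (L2 *v (R2 *v w))
    + (Q powi (1 + i - int k) * ?f - (Q - 1) * Q powi (i - int k) * ?g
      + (Q powi (1 + i + j - int k) + Q powi (1 + int h - j) - Q powi (1 + i - int k) - Q) / (Q - 1)) *s w"
    unfolding Omega2_wt[OF w] F F_zero_scalar[OF w lam]
    by (simp add: vec_eq_iff ring_distribs)
  also have "Q powi (1 + i - int k) * ?f - (Q - 1) * Q powi (i - int k) * ?g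
      + (Q powi (1 + i + j - int k) + Q powi (1 + int h - j) - Q powi (1 + i - int k) - Q) / (Q - 1)
      = (c * Q powi (j + 1) + Q powi (int h - j) - Q - 1) / (Q - 1)"
    using of_nat_q_nontrivial by (simp add: powi_simps divide_simps) (simp add: algebra_simps power2_eq_square)?
  finally show ?thesis .
qed

lemma wt_linear:
  shows "x \<in> wt i j \<Longrightarrow> a *s x \<in> wt i j"
    and "\<lbrakk>x \<in> wt i j; z \<in> wt i j\<rbrakk> \<Longrightarrow> x + z \<in> wt i j"
proof -
  show "x \<in> wt i j \<Longrightarrow> a *s x \<in> wt i j" by (simp add: wt_def)
  have "(x + z) $ u \<noteq> 0 \<Longrightarrow> x $ u \<noteq> 0 \<or> z $ u \<noteq> 0" for u by auto
  thus "\<lbrakk>x \<in> wt i j; z \<in> wt i j\<rbrakk> \<Longrightarrow> x + z \<in> wt i j" unfolding wt_def by blast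
qed

lemma Omega_wt_closed:
  assumes w: "w \<in> wt i j"
  shows "Omega0 *v w \<in> wt i j" "Omega1 *v w \<in> wt i j" "Omega2 *v w \<in> wt i j"
  unfolding Omega0_wt[OF w] Omega1_wt[OF w] Omega2_wt[OF w]
  by (intro wt_linear w generators_wt(5-7)[OF w])+

lemma Omega0_commutes:
  assumes "w \<in> wt i j" "A \<in> {L1, L2, R1, R2}"
  shows "Omega0 *v (A *v w) = A *v (Omega0 *v w)"
  using assms Omega0_L1 Omega0_L2 Omega0_R1 Omega0_R2 by blast

text \<open>
  For \<open>L2\<close> and \<open>R2\<close> the power of \<open>q\<close> from moving \<open>R1 L1\<close> past them cancels the change of \<open>q^(-j)\<close>.
  For \<open>L1\<close> and \<open>R1\<close> the commutator of \<open>L1\<close> and \<open>R1\<close> is a scalar on the weight space, which accounts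
  for the change of the diagonal term.
\<close>

lemma Omega1_commutes:
  assumes sub: "H_submodule W" and lam: "\<And>w. w \<in> W \<Longrightarrow> Omega0 *v w = c *s w"
    and W: "w \<in> W" and w: "w \<in> wt i j" and A: "A \<in> {L1, L2, R1, R2}"
  shows "Omega1 *v (A *v w) = A *v (Omega1 *v w)"
proof -
  let ?e = "\<lambda>i. (c * Q powi (int k - i + 1) + Q powi i - Q - 1) / (Q - 1)"
  let ?s = "\<lambda>i. (c * Q powi (int k + j - i) - Q powi (i + j)) / (Q - 1)"
  note gW = submodule_closed[OF sub W] and gw = generators_wt[OF w]
  have p: "Q powi (1 - j) = Q * Q powi (- j)" "Q powi (- j) = Q powi (- (j + 1)) * Q"
    using of_nat_q_nontrivial by (simp_all add: powi_simps field_simps)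
  have e: "?e i = ?e (i - 1) - (Q - 1) * Q powi (- j) * ?s (i - 1)"
    "?e (i + 1) = ?e i - (Q - 1) * Q powi (- j) * ?s i"
    using of_nat_q_nontrivial by (simp_all add: powi_simps divide_simps) (simp_all add: algebra_simps power2_eq_square)?
  consider "A = L1" | "A = L2" | "A = R1" | "A = R2" using A by blast
  thus ?thesis
  proof cases
    case 1
    have c: "R1 *v (L1 *v (L1 *v w)) = L1 *v (R1 *v (L1 *v w)) - ?s (i - 1) *s (L1 *v w)"
      using L1_R1_commutator_scalar[OF gw(1) lam[OF gW(1)]] by simp
    show ?thesis
      unfolding 1 Omega1_scalar[OF w lam[OF W]] Omega1_scalar[OF gw(1) lam[OF gW(1)]] c e
      by (simp add: mat_vec_simps vec_eq_iff ring_distribs)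
  next
    case 2
    show ?thesis
      unfolding 2 Omega1_scalar[OF w lam[OF W]] Omega1_scalar[OF gw(3) lam[OF gW(2)]]
      by (simp add: mat_vec_simps L2_L1 p flip: R1_L2)
  next
    case 3
    have c: "L1 *v (R1 *v w) = R1 *v (L1 *v w) + ?s i *s w"
      by (rule L1_R1_commutator_scalar[OF w lam[OF W]])
    show ?thesis
      unfolding 3 Omega1_scalar[OF w lam[OF W]] Omega1_scalar[OF gw(2) lam[OF gW(3)]] c e
      by (simp add: mat_vec_simps vec_eq_iff ring_distribs)
  next
    case 4
    show ?thesis
      unfolding 4 Omega1_scalar[OF w lam[OF W]] Omega1_scalar[OF gw(4) lam[OF gW(4)]] p(2)
      by (simp add: mat_vec_simps L1_R2 R1_R2)
  qed
qed

text \<open>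
  The same argument with \<open>L2 R2\<close> in place of \<open>R1 L1\<close>; the roles of the two pairs of generators are
  exchanged.
\<close>

lemma Omega2_commutes:
  assumes sub: "H_submodule W" and lam: "\<And>w. w \<in> W \<Longrightarrow> Omega0 *v w = c *s w"
    and W: "w \<in> W" and w: "w \<in> wt i j" and A: "A \<in> {L1, L2, R1, R2}"
  shows "Omega2 *v (A *v w) = A *v (Omega2 *v w)"
proof -
  let ?e = "\<lambda>j. (c * Q powi (j + 1) + Q powi (int h - j) - Q - 1) / (Q - 1)"
  let ?t = "\<lambda>j. (c * Q powi (int k + j - i) - Q powi (int h + int k - i - j)) / (Q - 1)"
  note gW = submodule_closed[OF sub W] and gw = generators_wt[OF w]
  have p: "Q powi (i - int k) = Q * Q powi (i - 1 - int k)"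
    "Q powi (i + 1 - int k) = Q * Q powi (i - int k)"
    using of_nat_q_nontrivial by (simp_all add: powi_simps)
  have e: "?e (j - 1) = ?e j - (Q - 1) * Q powi (i - int k) * ?t j"
    "?e j = ?e (j + 1) - (Q - 1) * Q powi (i - int k) * ?t (j + 1)"
    using of_nat_q_nontrivial by (simp_all add: powi_simps divide_simps)
      (simp_all add: algebra_simps power2_eq_square)?
  consider "A = L1" | "A = L2" | "A = R1" | "A = R2" using A by blast
  thus ?thesis
  proof cases
    case 1
    show ?thesis
      unfolding 1 Omega2_scalar[OF w lam[OF W]] Omega2_scalar[OF gw(1) lam[OF gW(1)]] p(1)
      by (simp add: mat_vec_simps L2_L1 mult_ac flip: L1_R2)
  next
    case 2
    have c: "R2 *v (L2 *v w) = L2 *v (R2 *v w) + ?t j *s w"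
      by (rule R2_L2_commutator_scalar[OF w lam[OF W]])
    show ?thesis
      unfolding 2 Omega2_scalar[OF w lam[OF W]] Omega2_scalar[OF gw(3) lam[OF gW(2)]] c e(1)
      by (simp add: mat_vec_simps vec_eq_iff ring_distribs)
  next
    case 3
    show ?thesis
      unfolding 3 Omega2_scalar[OF w lam[OF W]] Omega2_scalar[OF gw(2) lam[OF gW(3)]] p(2)
      by (simp add: mat_vec_simps R1_L2 R1_R2 mult_ac)
  next
    case 4
    have c: "L2 *v (R2 *v (R2 *v w)) = R2 *v (L2 *v (R2 *v w)) - ?t (j + 1) *s (R2 *v w)"
      using R2_L2_commutator_scalar[OF gw(4) lam[OF gW(4)]] by simp
    show ?thesis
      unfolding 4 Omega2_scalar[OF w lam[OF W]] Omega2_scalar[OF gw(4) lam[OF gW(4)]] c e(2)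
      by (simp add: mat_vec_simps vec_eq_iff ring_distribs)
  qed
qed

section \<open>The values of the scalars\<close>

lemma Estar_image:
  assumes "H_submodule W"
  shows "(\<lambda>w. Estar i j *v w) ` W = W \<inter> wt (int i) (int j)"
  using submodule_closed(5)[OF assms] Estar_wt Estar_fixes_wt by (force simp: image_iff)

lemma weight_space_trivial:
  assumes sub: "H_submodule W" and ty: "has_type W \<alpha> \<beta> \<rho>"
    and w: "w \<in> W" "w \<in> wt i j" and j: "j \<le> int h"
    and out: "\<not> (\<alpha> \<le> i \<and> i \<le> int k - \<rho> - \<alpha> \<and> \<rho> + \<beta> \<le> j \<and> j \<le> int h - \<beta>)"
  shows "w = 0"
proof (rule ccontr)
  assume "w \<noteq> 0"
  then obtain u where "w $ u \<noteq> 0" by (auto simp: vec_eq_iff)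
  hence u: "int (dim (u \<inter> y)) = i" "int (dim u) = i + j" using w by (auto simp: wt_def)
  have "dim (u \<inter> y) \<le> k" "dim (u \<inter> y) \<le> dim u"
    using fd.dim_subset[of "u \<inter> y" y] fd.dim_subset[of "u \<inter> y" u] dim_y by auto
  hence ij: "nat i \<le> k" "nat j \<le> h" "0 \<le> i" "0 \<le> j" using u j by auto
  hence "vec.dim ((\<lambda>w. Estar (nat i) (nat j) *v w) ` W) = 0"
    using ty out unfolding has_type_def by auto
  hence "vec.dim (W \<inter> wt i j) = 0" unfolding Estar_image[OF sub] using ij by simp
  thus False using w \<open>w \<noteq> 0\<close> by auto
qed

lemma weight_space_line:
  assumes sub: "H_submodule W" and ty: "has_type W \<alpha> \<beta> \<rho>"
    and i: "\<alpha> \<le> i" "i \<le> int k - \<rho> - \<alpha>" and j: "\<rho> + \<beta> \<le> j" "j \<le> int h - \<beta>"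
  obtains b where "b \<in> W" "b \<in> wt i j" "b \<noteq> 0"
    "\<And>w. \<lbrakk>w \<in> W; w \<in> wt i j\<rbrakk> \<Longrightarrow> \<exists>c. w = c *s b"
proof -
  have "0 \<le> \<alpha>" "0 \<le> \<beta>" "0 \<le> \<rho>" using ty by (auto simp: has_type_def)
  hence ij: "0 \<le> i" "0 \<le> j" "nat i \<le> k" "nat j \<le> h" using i j by auto
  hence "vec.dim ((\<lambda>w. Estar (nat i) (nat j) *v w) ` W) = 1"
    using ty i j unfolding has_type_def by auto
  hence d: "vec.dim (W \<inter> wt i j) = 1" unfolding Estar_image[OF sub] using ij by simp
  obtain B where B: "B \<subseteq> W \<inter> wt i j" "vec.independent B" "W \<inter> wt i j \<subseteq> vec.span B" "card B = 1"
    using vec.basis_exists[of "W \<inter> wt i j"] d by metis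
  then obtain b where b: "B = {b}" by (auto simp: card_1_singleton_iff)
  show thesis
  proof (rule that[of b])
    show "b \<in> W" "b \<in> wt i j" using B b by auto
    show "b \<noteq> 0" using B(2) b by simp
    show "\<exists>c. w = c *s b" if "w \<in> W" "w \<in> wt i j" for w
      using B(3) that unfolding b vec.span_singleton by blast
  qed
qed

text \<open>
  The weight vector \<open>b\<close> at \<open>(\<alpha>, \<rho> + \<beta>)\<close> is killed by \<open>L1\<close> and \<open>L2\<close>, and \<open>t\<close> at
  \<open>(k - \<rho> - \<alpha>, \<rho> + \<beta>)\<close> is killed by \<open>R1\<close>.  The vector \<open>b\<close> provides all three scalars in terms of
  the scalar \<open>c\<close> of \<open>Omega0\<close>; the vector \<open>t\<close> provides the equation for \<open>c\<close>.
\<close>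

lemma Omega_scalars:
  assumes irr: "irreducible_H_module W" and ty: "has_type W \<alpha> \<beta> \<rho>" and w: "w \<in> W"
  shows "Omega0 *v w = (Q powi (- \<rho>)) *s w"
    and "Omega1 *v w = (Q * q_bracket q (int k - \<rho> - \<alpha>) + q_bracket q \<alpha>) *s w"
    and "Omega2 *v w = (Q * q_bracket q (int h - \<rho> - \<beta>) + q_bracket q \<beta>) *s w"
proof -
  have sub: "H_submodule W" using irr by (simp add: irreducible_H_module_def)
  have nn: "0 \<le> \<alpha>" "0 \<le> \<beta>" "0 \<le> \<rho>" "\<alpha> \<le> int k - \<rho> - \<alpha>" "\<rho> + \<beta> \<le> int h - \<beta>"
    using ty by (auto simp: has_type_def)
  define j where "j = \<rho> + \<beta>"
  define i1 where "i1 = int k - \<rho> - \<alpha>"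
  obtain b where b: "b \<in> W" "b \<in> wt \<alpha> j" "b \<noteq> 0"
    and b_line: "\<And>w. \<lbrakk>w \<in> W; w \<in> wt \<alpha> j\<rbrakk> \<Longrightarrow> \<exists>c. w = c *s b"
    by (rule weight_space_line[OF sub ty, of \<alpha> j]) (use nn j_def in auto)
  obtain t where t: "t \<in> W" "t \<in> wt i1 j" "t \<noteq> 0"
    by (rule weight_space_line[OF sub ty, of i1 j]) (use nn j_def i1_def in auto)
  note bW = submodule_closed[OF sub b(1)] and bw = generators_wt[OF b(2)]
  have b0: "L1 *v b = 0" "L2 *v b = 0"
    by (rule weight_space_trivial[OF sub ty bW(1) bw(1)]; use nn j_def in simp)
      (rule weight_space_trivial[OF sub ty bW(2) bw(3)]; use nn j_def in simp)
  have t0: "R1 *v t = 0"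
    by (rule weight_space_trivial[OF sub ty submodule_closed(3)[OF sub t(1)] generators_wt(2)[OF t(2)]];
        use nn j_def i1_def in simp)

  \<comment> \<open>The weight space of \<open>b\<close> is a line, so \<open>b\<close> is an eigenvector once \<open>Omega0\<close> is known to preserve \<open>W\<close>.\<close>
  have "Omega0 *v b \<in> W"
  proof -
    have "F_zero *v b \<in> W" unfolding F_zero_eq1[OF b(2)]
      by (intro submodule_linear[OF sub] submodule_closed[OF sub] b)
    thus ?thesis unfolding Omega0_wt[OF b(2)] by (intro submodule_linear[OF sub] b)
  qed
  then obtain c where c: "Omega0 *v b = c *s b" using b_line Omega_wt_closed(1)[OF b(2)] by blast
  have lam: "Omega0 *v w = c *s w" if "w \<in> W" for w
    by (rule schur[OF irr _ _ b(1,3) c that]) (auto intro: Omega_wt_closed Omega0_commutes)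

  let ?e = "\<lambda>i. (c * Q powi (int k - i + 1) + Q powi i - Q - 1) / (Q - 1)"
  have O1b: "Omega1 *v b = ?e \<alpha> *s b"
    using Omega1_scalar[OF b(2) c] b0 by simp
  have O1: "Omega1 *v w = ?e \<alpha> *s w" if "w \<in> W" for w
    by (rule schur[OF irr _ _ b(1,3) O1b that])
      (auto intro: Omega_wt_closed Omega1_commutes[OF sub lam])

  let ?s = "(c * Q powi (int k + j - i1) - Q powi (i1 + j)) / (Q - 1)"
  \<comment> \<open>Because \<open>R1\<close> kills \<open>t\<close>, the commutator determines \<open>R1 L1\<close> on \<open>t\<close>.\<close>
  have "R1 *v (L1 *v t) = (- ?s) *s t"
    using L1_R1_commutator_scalar[OF t(2) lam[OF t(1)]] t0
    by (simp add: eq_neg_iff_add_eq_0)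
  hence "Omega1 *v t = (?e i1 - (Q - 1) * Q powi (- j) * ?s) *s t"
    unfolding Omega1_scalar[OF t(2) lam[OF t(1)]]
    by (simp only: vector_smult_assoc vector_sadd_rdistrib[symmetric]) simp
  hence "?e \<alpha> *s t = (?e i1 - (Q - 1) * Q powi (- j) * ?s) *s t" using O1[OF t(1)] by simp
  hence "?e \<alpha> = ?e i1 - (Q - 1) * Q powi (- j) * ?s"
    using t(3) unfolding vec.scale_cancel_right by blast
  also have "\<dots> = (c * Q powi (\<rho> + \<alpha>) + Q powi (int k - \<rho> - \<alpha> + 1) - Q - 1) / (Q - 1)"
    using of_nat_q_nontrivial unfolding i1_def by (simp add: powi_simps divide_simps) (simp add: algebra_simps power2_eq_square)?
  finally have "c * Q powi (int k - \<alpha> + 1) + Q powi \<alpha> =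
      c * Q powi (\<rho> + \<alpha>) + Q powi (int k - \<rho> - \<alpha> + 1)"
    using of_nat_q_nontrivial by simp
  moreover have "Q powi \<alpha> = Q powi (- \<rho>) * Q powi (\<rho> + \<alpha>)"
    "Q powi (int k - \<rho> - \<alpha> + 1) = Q powi (- \<rho>) * Q powi (int k - \<alpha> + 1)"
    using of_nat_q_nontrivial by (simp_all add: algebra_simps flip: power_int_add)
  ultimately have "c * (Q powi (int k - \<alpha> + 1) - Q powi (\<rho> + \<alpha>)) =
      Q powi (- \<rho>) * (Q powi (int k - \<alpha> + 1) - Q powi (\<rho> + \<alpha>))"
    by (simp add: algebra_simps)
  \<comment> \<open>Cancellation is possible because \<open>\<rho> + 2\<alpha> \<le> k\<close>, so the two exponents differ.\<close>
  moreover have "Q powi (int k - \<alpha> + 1) \<noteq> Q powi (\<rho> + \<alpha>)"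
  proof -
    have "q ^ nat (\<rho> + \<alpha>) < q ^ nat (int k - \<alpha> + 1)"
      using q_ge_2 nn by (intro power_strict_increasing) auto
    hence "Q ^ nat (\<rho> + \<alpha>) \<noteq> Q ^ nat (int k - \<alpha> + 1)"
      by (metis less_irrefl of_nat_eq_iff of_nat_power)
    thus ?thesis using nn by (simp add: power_int_def)
  qed
  ultimately have c_eq: "c = Q powi (- \<rho>)" by simp
  show "Omega0 *v w = (Q powi (- \<rho>)) *s w" using lam[OF w] c_eq by simp
  have "?e \<alpha> = Q * q_bracket q (int k - \<rho> - \<alpha>) + q_bracket q \<alpha>"
    using of_nat_q_nontrivial unfolding c_eq by (simp add: powi_simps divide_simps) (simp add: algebra_simps power2_eq_square)?
  thus "Omega1 *v w = (Q * q_bracket q (int k - \<rho> - \<alpha>) + q_bracket q \<alpha>) *s w"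
    using O1[OF w] by simp

  let ?t = "(c * Q powi (int k + j - \<alpha>) - Q powi (int h + int k - \<alpha> - j)) / (Q - 1)"
  let ?m = "(c * Q powi (j + 1) + Q powi (int h - j) - Q - 1) / (Q - 1)
      - (Q - 1) * Q powi (\<alpha> - int k) * ?t"
  \<comment> \<open>Likewise \<open>L2\<close> kills \<open>b\<close>, which determines \<open>L2 R2\<close> on \<open>b\<close>.\<close>
  have "L2 *v (R2 *v b) = (- ?t) *s b"
    using R2_L2_commutator_scalar[OF b(2) c] b0
    by (simp add: eq_neg_iff_add_eq_0)
  hence O2b: "Omega2 *v b = ?m *s b"
    unfolding Omega2_scalar[OF b(2) c]
    by (simp only: vector_smult_assoc vector_sadd_rdistrib[symmetric]) simp
  have O2: "Omega2 *v w = ?m *s w"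
    by (rule schur[OF irr _ _ b(1,3) O2b w])
      (auto intro: Omega_wt_closed Omega2_commutes[OF sub lam])
  have "?m = Q * q_bracket q (int h - \<rho> - \<beta>) + q_bracket q \<beta>"
    using of_nat_q_nontrivial unfolding c_eq j_def by (simp add: powi_simps divide_simps) (simp add: algebra_simps power2_eq_square)?
  thus "Omega2 *v w = (Q * q_bracket q (int h - \<rho> - \<beta>) + q_bracket q \<beta>) *s w"
    using O2 by simp
qed

end

theorem theorem4p4:
  fixes scale :: "'f::{field,finite} \<Rightarrow> 'v::{ab_group_add,finite} \<Rightarrow> 'v"
    and q h k :: nat and y :: "'v set"
    and W :: "(complex ^ 'v set) set"
    and \<alpha> \<beta> \<rho> :: int
  assumes "subspace_lattice scale q h k y"
    and "subspace_lattice.irreducible_H_module scale q h k y W"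
    and "subspace_lattice.has_type scale h k y W \<alpha> \<beta> \<rho>"
  shows "(\<forall>w \<in> W. subspace_lattice.Omega0 scale q h k y *v w = (of_nat q powi (- \<rho>)) *s w)
    \<and> (\<forall>w \<in> W. subspace_lattice.Omega1 scale q h k y *v w =
          (of_nat q * q_bracket q (int k - \<rho> - \<alpha>) + q_bracket q \<alpha>) *s w)
    \<and> (\<forall>w \<in> W. subspace_lattice.Omega2 scale q h k y *v w =
          (of_nat q * q_bracket q (int h - \<rho> - \<beta>) + q_bracket q \<beta>) *s w)"
  using subspace_lattice.Omega_scalars[OF assms] by blast

end
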